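(* Let $q$ be a power of a prime, $m$ a positive integer, $n=q^m-1$, and let $\delta$ be an integer with $2\le\delta\le q^{\lceil m/2\rceil}-1-(q-2)[m\text{ odd}]$. Then there exists a subsystem BCH code with parameters $$[[q^m-1,\;n-2m\lceil(\delta-1)(1-1/q)\rceil-r,\;r,\;\ge\delta]]_q,$$ where $0\le r<n-2m\lceil(\delta-1)(1-1/q)\rceil$ (i.e. for every integer $r$ in this range).
   Context: $[P]$ is $1$ if $P$ is true and $0$ otherwise. "Subsystem BCH code" is an informal name for a subsystem code derived from a (primitive, narrow-sense) BCH code, i.e. the cyclic code of length $n=q^m-1$ over $\mathbf{F}_q$ whose generator polynomial has as roots $\alpha^t$, $t\in\bigcup_{a=1}^{\delta-1}\{aq^i\bmod n: i\ge 0\}$, with $\alpha$ a primitive $n$-th root of unity; the assertion is the existence of a subsystem code with the stated parameters. Subsystem codes: let $p$ be the characteristic of $\mathbf{F}_q$. For $(x|y)\in\mathbf{F}_q^{2n}$ (with $x,y\in\mathbf{F}_q^n$), $\mathrm{swt}(x|y)$ is the number of $i$ with $(x_i,y_i)\ne(0,0)$, and $\mathrm{swt}(S)$ is the minimum of $\mathrm{swt}$ over the nonzero elements of $S$. The trace-symplectic product of $(a|b)$ and $(a'|b')$ is $\mathrm{tr}_{q/p}(a'\cdot b-a\cdot b')$, and $X^{\perp_s}$ is the dual of $X\subseteq\mathbf{F}_q^{2n}$ with respect to it. All subsystem codes are Clifford subsystem codes: an $((n,K,R,d))_q$ subsystem code is a subspace $Q=A\otimes B$ of $\mathbf{C}^{q^n}$,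 $\dim A=K$, $\dim B=R$, arising from an additive code; concretely, its existence means that there is an additive subgroup $X\le\mathbf{F}_q^{2n}$ (the zero code is allowed) with $Y=X\cap X^{\perp_s}$ such that $|X|=q^nR/K$, $|Y|=q^n/(KR)$, and $d=\mathrm{swt}(Y^{\perp_s}\setminus X)$ if $Y^{\perp_s}\ne X$, while $d=\mathrm{swt}(Y^{\perp_s})$ if $Y^{\perp_s}=X$ (the case $K=1$). $[[n,k,r,d]]_q$ means $((n,q^k,q^r,d))_q$; writing $\ge\delta$ in the last position means that the minimum distance is some $d\ge\delta$. *)

theory Defs
  imports "HOL-Library.Cardinality" "Jordan_Normal_Form.Matrix" "HOL-Algebra.Group"
begin

text \<open>
  The field $F_q$ is a type \<open>'a\<close> of class \<open>{finite, field}\<close> with \<open>q = CARD('a)\<close>, and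
  $(x|y) \in F_q^{2n}$ is the pair \<open>(x, y)\<close> with \<open>x, y \<in> carrier_vec n\<close>.
\<close>

abbreviation symp_group :: "'a::field itself \<Rightarrow> nat \<Rightarrow> ('a vec \<times> 'a vec) monoid" where
  "symp_group T n \<equiv> monoid_vec T n \<times>\<times> monoid_vec T n"

text \<open>
  The absolute trace $x + x^p + \dots + x^{p^{e-1}}$, where $q = p^e$. Its values lie in the
  prime subfield $F_p$ of \<open>'a\<close>.
\<close>

definition abs_trace :: "'a::{finite,field} \<Rightarrow> 'a" where
  "abs_trace x = (\<Sum>i < (THE e. CARD('a) = CHAR('a) ^ e). x ^ (CHAR('a) ^ i))"

definition trace_symp :: "'a::{finite,field} vec \<times> 'a vec \<Rightarrow> 'a vec \<times> 'a vec \<Rightarrow> 'a" where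
  "trace_symp v w = (case (v, w) of ((a, b), (a', b')) \<Rightarrow> abs_trace (a' \<bullet> b - a \<bullet> b'))"

definition symp_dual ::
    "nat \<Rightarrow> ('a::{finite,field} vec \<times> 'a vec) set \<Rightarrow> ('a vec \<times> 'a vec) set" where
  "symp_dual n X = {v \<in> carrier_vec n \<times> carrier_vec n. \<forall>w\<in>X. trace_symp v w = 0}"

definition swt :: "nat \<Rightarrow> 'a::zero vec \<times> 'a vec \<Rightarrow> nat" where
  "swt n v = card {i. i < n \<and> (fst v $ i, snd v $ i) \<noteq> (0, 0)}"

definition min_swt :: "nat \<Rightarrow> ('a::zero vec \<times> 'a vec) set \<Rightarrow> nat" where
  "min_swt n S = Min (swt n ` (S - {(0\<^sub>v n, 0\<^sub>v n)}))"

text \<open>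
  Existence of an $((n,K,R,d))_q$ Clifford subsystem code, in terms of the additive code \<open>X\<close>
  it arises from. The case \<open>symp_dual n Y = X\<close> is the case \<open>K = 1\<close>.
\<close>

definition exists_subsystem_code_dims ::
    "'a::{finite,field} itself \<Rightarrow> nat \<Rightarrow> nat \<Rightarrow> nat \<Rightarrow> nat \<Rightarrow> bool" where
  "exists_subsystem_code_dims T n K R d \<longleftrightarrow> K \<ge> 1 \<and> R \<ge> 1 \<and>
     (\<exists>(X :: ('a vec \<times> 'a vec) set) Y.
        subgroup X (symp_group T n) \<and>
        Y = X \<inter> symp_dual n X \<and>
        real (card X) = real CARD('a) ^ n * real R / real K \<and>
        real (card Y) = real CARD('a) ^ n / (real K * real R) \<and>
        d = (if symp_dual n Y \<noteq> X then min_swt n (symp_dual n Y - X)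
             else min_swt n (symp_dual n Y)))"

definition exists_subsystem_code ::
    "'a::{finite,field} itself \<Rightarrow> nat \<Rightarrow> nat \<Rightarrow> nat \<Rightarrow> nat \<Rightarrow> bool" where
  "exists_subsystem_code T n k r d \<longleftrightarrow>
     exists_subsystem_code_dims T n (CARD('a) ^ k) (CARD('a) ^ r) d"

end

theory Submission
  imports Defs "HOL-Algebra.Algebraic_Closure_Type" "HOL-Algebra.Sylow"
begin

text \<open>
  Let \<open>\<beta>\<^sub>i\<close> run through the \<open>n\<close>-th roots of unity in the algebraic closure of \<open>F\<^sub>q\<close>, and let \<open>T\<close> be the
  set of the positive \<open>a < \<delta>\<close> not divisible by \<open>q\<close>. The words \<open>(Tr \<Sum>\<^bsub>a \<in> T\<^esub> c\<^sub>a \<beta>\<^sub>i\<^sup>a)\<^sub>i\<close> form a code \<open>D\<close> with at most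
  \<open>q\<^sup>s\<close> elements, \<open>s = m |T|\<close>, whose dual is the BCH code. Since \<open>n\<close> divides no \<open>a q\<^sup>i + b\<close> with
  \<open>a, b \<in> T\<close>, the power sums of the \<open>\<beta>\<^sub>i\<close> vanish and \<open>D\<close> is self-orthogonal. Starting from
  \<open>X = D \<times> D\<close>, one adjoins isotropic vectors until \<open>|Y| = q\<^bsup>2s\<^esup>\<close>, and then \<open>r\<close> hyperbolic pairs. This
  keeps \<open>Y\<^sup>\<bottom> \<subseteq> D\<^sup>\<bottom> \<times> D\<^sup>\<bottom>\<close>, so the distance is at least \<open>\<delta>\<close>, and it needs only the upper bound on
  \<open>|D|\<close>, not the exact dimension of the BCH code.
\<close>

no_notation fps_nth (infixl \<open>$\<close> 75)

section \<open>Finite fields\<close>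

text \<open>If a prime \<open>r\<close> divides the order, Sylow's theorem gives an additive
  subgroup of order \<open>r\<close>. Its nonzero elements are annihilated by \<open>r\<close>, so
  the characteristic divides \<open>r\<close> and equals it.\<close>

lemma card_field_eq_CHAR_power: "\<exists>e. CARD('a::{finite,field}) = CHAR('a) ^ e"
proof -
  let ?p = "CHAR('a)"
  have p: "Factorial_Ring.prime ?p"
    using finite_imp_CHAR_pos[where 'a='a, OF finite] prime_CHAR_semidom by auto
  define G :: "'a monoid" where "G = \<lparr>carrier = UNIV, mult = (+), one = 0\<rparr>"
  interpret G: group G
    by (rule groupI) (auto simp: G_def add.assoc intro: exI[of _ "- x" for x])
  have pow: "x [^]\<^bsub>G\<^esub> k = of_nat k * x" for x :: 'a and k :: nat
    by (induction k) (auto simp: nat_pow_def G_def algebra_simps)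
  have "r = ?p" if r: "Factorial_Ring.prime r" "r dvd CARD('a)" for r :: nat
  proof -
    obtain l where l: "CARD('a) = r * l" using r by (elim dvdE)
    obtain H where H: "subgroup H G" "card H = r"
      using sylow_thm[OF r(1) G.is_group, of 1 l] l by (auto simp: Coset.order_def G_def)
    have "card H > 1" using H r prime_gt_1_nat by auto
    hence "\<not> H \<subseteq> {0}" using card_mono[of "{0}" H] by auto
    then obtain h where h: "h \<in> H" "h \<noteq> 0" by blast
    interpret H: group "G\<lparr>carrier := H\<rparr>"
      using H(1) by (rule G.subgroup_imp_group)
    have "h [^]\<^bsub>G\<lparr>carrier := H\<rparr>\<^esub> r = \<one>\<^bsub>G\<lparr>carrier := H\<rparr>\<^esub>"
      using H.pow_order_eq_1[of h] h H by (simp add: Coset.order_def)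
    hence "h [^]\<^bsub>G\<^esub> r = \<one>\<^bsub>G\<^esub>"
      by (simp add: nat_pow_def)
    hence "of_nat r * h = 0" by (simp only: pow) (simp add: G_def)
    hence "of_nat r = (0 :: 'a)" using h by simp
    hence "?p dvd r" by (simp add: of_nat_eq_0_iff_char_dvd)
    thus ?thesis using primes_dvd_imp_eq[OF p r(1)] by simp
  qed
  hence "prime_factors CARD('a) \<subseteq> {?p}" by (auto simp: in_prime_factors_iff)
  hence "set_mset (prime_factorization CARD('a)) \<subseteq> {?p}" .
  hence "prime_factorization CARD('a) = replicate_mset (size (prime_factorization CARD('a))) ?p"
    by (metis set_mset_subset_singletonD)
  hence "prod_mset (prime_factorization CARD('a)) = ?p ^ size (prime_factorization CARD('a))"
    by (metis prod_mset_replicate_mset)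
  thus ?thesis
    by (metis prod_mset_prime_factorization_nat zero_less_card_finite)
qed

text \<open>Multiplication by a nonzero \<open>x\<close> permutes the nonzero elements; comparing
  their products gives \<open>x ^ (q - 1) = 1\<close>.\<close>

lemma finite_field_power_card:
  fixes x :: "'a::{finite,field}"
  shows "x ^ CARD('a) = x"
proof (cases "x = 0")
  case False
  have "(\<Prod>y\<in>UNIV-{0}. x * y) = (\<Prod>y\<in>UNIV-{0}. y)"
    by (rule prod.reindex_bij_witness[of _ "\<lambda>y. y / x" "\<lambda>y. x * y"]) (use False in auto)
  hence "x ^ (CARD('a) - 1) * (\<Prod>y\<in>UNIV-{0::'a}. y) = (\<Prod>y\<in>UNIV-{0}. y)"
    by (simp add: prod.distrib card_Diff_subset)
  hence "x ^ (CARD('a) - 1) = 1" by simp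
  hence "x * x ^ (CARD('a) - 1) = x" by simp
  thus ?thesis by (metis One_nat_def Suc_pred power_Suc zero_less_card_finite)
qed auto

lemma finite_field_power_card_power:
  fixes x :: "'a::{finite,field}"
  shows "x ^ (CARD('a) ^ u) = x"
  by (induction u) (simp_all add: power_mult finite_field_power_card)

text \<open>As a polynomial in \<open>x\<close> the sum has degree at most
  \<open>b ^ (k - 1)\<close>, too small to vanish on all of \<open>A\<close>. It serves both the
  absolute trace and the trace from \<open>ext\<close>.\<close>

lemma linearized_sum_nonzero:
  fixes A :: "'b::idom set"
  assumes "finite A" "card A = b ^ k" "b \<ge> 2" "k \<ge> 1"
  shows "\<exists>x\<in>A. (\<Sum>i<k. x ^ (b ^ i)) \<noteq> 0"
proof (rule ccontr)
  assume *: "\<not> ?thesis"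
  define P :: "'b poly" where "P = (\<Sum>i<k. Polynomial.monom 1 (b ^ i))"
  \<comment> \<open>Since \<open>b \<ge> 2\<close>, only the summand \<open>i = 0\<close> is linear,
    so the coefficient is 1.\<close>
  have "Polynomial.coeff P 1 = (\<Sum>i<k. if i = 0 then 1 else 0)"
    unfolding P_def coeff_sum using assms(3) by (intro sum.cong) auto
  hence "P \<noteq> 0" using assms(4) by (auto simp: poly_eq_iff intro!: exI[of _ 1])
  have "Polynomial.degree P \<le> b ^ (k - 1)"
    unfolding P_def using assms
    by (intro degree_sum_le) (auto intro!: order.trans[OF degree_monom_le] power_increasing)
  moreover have "A \<subseteq> {x. poly P x = 0}"
    using * by (auto simp: P_def poly_sum poly_monom)
  hence "card A \<le> Polynomial.degree P"
    using card_mono[OF poly_roots_finite[OF \<open>P \<noteq> 0\<close>]] card_poly_roots_bound[OF \<open>P \<noteq> 0\<close>]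
    by (meson order.trans)
  moreover have "b ^ (k - 1) < b ^ k" using assms by (intro power_strict_increasing) auto
  ultimately show False using assms by linarith
qed

lemma CARD_field_ge_2: "CARD('a::{finite,field}) \<ge> 2"
  using card_mono[of UNIV "{0, 1 :: 'a}"] by simp

lemma abs_trace_0: "abs_trace (0 :: 'a::{finite,field}) = 0"
  using finite_imp_CHAR_pos[where 'a='a, OF finite] by (simp add: abs_trace_def power_0_left)

lemma abs_trace_nontrivial: "\<exists>x :: 'a::{finite,field}. abs_trace x \<noteq> 0"
proof -
  obtain e where e: "CARD('a) = CHAR('a) ^ e" using card_field_eq_CHAR_power by blast
  have p: "CHAR('a) \<ge> 2"
    using finite_imp_CHAR_pos[where 'a='a, OF finite] prime_CHAR_semidom prime_ge_2_nat by auto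
  have "e \<ge> 1" using e CARD_field_ge_2[where 'a='a] by (cases e) auto
  \<comment> \<open>The description in \<open>abs_trace\<close> is proper: powers of a base at least
    2 determine their exponent.\<close>
  moreover have "(THE e. CARD('a) = CHAR('a) ^ e) = e"
    using e p by (intro the_equality) auto
  ultimately show ?thesis
    using linearized_sum_nonzero[of "UNIV :: 'a set" "CHAR('a)" e] e p
    by (auto simp: abs_trace_def)
qed

section \<open>Roots of unity and their power sums\<close>

lemma card_nth_roots_of_unity:
  fixes n :: nat
  assumes "of_nat n \<noteq> (0 :: 'b::alg_closed_field)"
  shows "card {x :: 'b. x ^ n = 1} = n" "finite {x :: 'b. x ^ n = 1}"
proof -
  have n: "n > 0" using assms by (cases n) auto
  define P :: "'b poly" where "P = Polynomial.monom 1 n + [:-1:]"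
  have deg: "Polynomial.degree P = n"
    unfolding P_def using n by (subst degree_add_eq_left) (auto simp: degree_monom_eq)
  hence P: "P \<noteq> 0" using n by auto
  have roots: "{x. poly P x = 0} = {x. x ^ n = 1}" by (auto simp: P_def poly_monom)
  obtain A where A: "size A = n" "P = smult (lead_coeff P) (\<Prod>x\<in>#A. [:-x, 1:])"
    using alg_closed_imp_factorization[OF P] deg by auto
  have root_iff: "poly P x = 0 \<longleftrightarrow> x \<in># A" for x
    using P by (subst A(2)) (auto simp: poly_prod_mset prod_mset_zero_iff)
  \<comment> \<open>A double root would be a root of the derivative \<open>n X ^ (n - 1)\<close>,
    hence zero, but zero is not a root of \<open>P\<close>.\<close>
  have "count A x \<le> 1" for x
  proof (rule ccontr)
    assume "\<not> ?thesis"
    hence "{#x, x#} \<subseteq># A"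
      by (auto simp: subseteq_mset_def)
    then obtain B where B: "A = {#x, x#} + B" by (auto simp: subset_mset.le_iff_add)
    define Q where "Q = smult (lead_coeff P) (\<Prod>x\<in>#B. [:-x, 1:])"
    have PQ: "P = [:-x, 1:] * ([:-x, 1:] * Q)"
      unfolding Q_def by (subst A(2), subst B) simp
    have "poly (pderiv P) x = 0"
      by (subst PQ) (simp only: pderiv_mult poly_add poly_mult, simp)
    moreover have "poly (pderiv P) x = of_nat n * x ^ (n - 1)"
      by (simp add: P_def pderiv_add pderiv_monom poly_monom pderiv_pCons)
    ultimately have "x ^ (n - 1) = 0" using assms by simp
    hence "x = 0" by simp
    moreover have "poly P x = 0" using B root_iff by auto
    ultimately show False using n by (simp add: P_def poly_monom power_0_left)
  qed
  hence "A = mset_set (set_mset A)"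
    by (intro multiset_eqI) (auto simp: count_mset_set' le_antisym not_in_iff Suc_le_eq)
  hence "card (set_mset A) = n" using A(1) by (metis size_mset_set)
  moreover have "set_mset A = {x. x ^ n = 1}" using root_iff roots by auto
  ultimately show "card {x :: 'b. x ^ n = 1} = n" by simp
  show "finite {x :: 'b. x ^ n = 1}"
    using poly_roots_finite[OF P] roots by simp
qed

text \<open>Some root of unity \<open>g\<close> has \<open>g ^ k \<noteq> 1\<close>, because
  \<open>X ^ (k mod n) - 1\<close> has fewer than \<open>n\<close> roots. Multiplication by
  \<open>g\<close> permutes the roots of unity and scales the sum by \<open>g ^ k\<close>.\<close>

lemma sum_powers_of_roots_of_unity:
  fixes n k :: nat
  assumes "of_nat n \<noteq> (0 :: 'b::alg_closed_field)" "\<not> n dvd k"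
  shows "(\<Sum>x | x ^ n = (1 :: 'b). x ^ k) = 0"
proof -
  let ?U = "{x :: 'b. x ^ n = 1}"
  have n: "n > 0" using assms by (cases n) auto
  define r where "r = k mod n"
  have r: "0 < r" "r < n" using assms n by (auto simp: r_def mod_greater_zero_iff_not_dvd)
  define P :: "'b poly" where "P = Polynomial.monom 1 r + [:-1:]"
  have deg: "Polynomial.degree P = r"
    unfolding P_def using r by (subst degree_add_eq_left) (auto simp: degree_monom_eq)
  hence P: "P \<noteq> 0" using r by auto
  have "\<not> ?U \<subseteq> {x. poly P x = 0}"
    using card_mono[OF poly_roots_finite[OF P], of ?U] card_poly_roots_bound[OF P]
      card_nth_roots_of_unity[OF assms(1)] deg r by auto
  then obtain g where "g ^ n = 1" "poly P g \<noteq> 0" by auto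
  hence g: "g ^ n = 1" "g ^ r \<noteq> 1" by (auto simp: P_def poly_monom)
  have "k = n * (k div n) + r" by (simp add: r_def)
  hence gk: "g ^ k \<noteq> 1" using g by (metis power_add power_mult power_one mult_1)
  have "g \<noteq> 0" using g n by (auto simp: power_0_left)
  have "(\<Sum>x\<in>?U. x ^ k) = (\<Sum>x\<in>?U. (g * x) ^ k)"
    by (rule sum.reindex_bij_witness[of _ "\<lambda>x. g * x" "\<lambda>x. x / g"])
      (use g \<open>g \<noteq> 0\<close> in \<open>auto simp: power_mult_distrib power_divide\<close>)
  also have "\<dots> = g ^ k * (\<Sum>x\<in>?U. x ^ k)"
    by (simp add: power_mult_distrib sum_distrib_left)
  finally show ?thesis using gk by simp
qed

section \<open>Linear codes\<close>

definition linear_code :: "nat \<Rightarrow> 'a::field vec set \<Rightarrow> bool" where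
  "linear_code n L \<longleftrightarrow> L \<subseteq> carrier_vec n \<and> 0\<^sub>v n \<in> L \<and>
     (\<forall>x\<in>L. \<forall>y\<in>L. x + y \<in> L) \<and> (\<forall>c. \<forall>x\<in>L. c \<cdot>\<^sub>v x \<in> L)"

definition dual_code :: "nat \<Rightarrow> 'a::field vec set \<Rightarrow> 'a vec set" where
  "dual_code n L = {x \<in> carrier_vec n. \<forall>y\<in>L. x \<bullet> y = 0}"

definition adjoin :: "'a::field vec \<Rightarrow> 'a vec set \<Rightarrow> 'a vec set" where
  "adjoin e L = (\<lambda>(c, y). y + c \<cdot>\<^sub>v e) ` (UNIV \<times> L)"

lemma card_carrier_vec:
  "card (carrier_vec n :: 'a::finite vec set) = CARD('a) ^ n" "finite (carrier_vec n :: 'a vec set)"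
proof -
  have "bij_betw (\<lambda>f. vec n f) ({..<n} \<rightarrow>\<^sub>E (UNIV :: 'a set)) (carrier_vec n)"
  proof (rule bij_betwI[where g = "\<lambda>v. restrict (\<lambda>i. v $ i) {..<n}"])
    fix f assume "f \<in> {..<n} \<rightarrow>\<^sub>E (UNIV :: 'a set)"
    thus "restrict (\<lambda>i. vec n f $ i) {..<n} = f"
      by (intro ext) (auto simp: restrict_def PiE_def extensional_def)
  qed (auto intro!: eq_vecI)
  from bij_betw_same_card[OF this] bij_betw_finite[OF this]
  show "card (carrier_vec n :: 'a vec set) = CARD('a) ^ n" "finite (carrier_vec n :: 'a vec set)"
    by (auto simp: card_PiE finite_PiE)
qed

lemma linear_codeD:
  assumes "linear_code n L"
  shows "L \<subseteq> carrier_vec n" "0\<^sub>v n \<in> L" "x \<in> L \<Longrightarrow> y \<in> L \<Longrightarrow> x + y \<in> L"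
    "x \<in> L \<Longrightarrow> c \<cdot>\<^sub>v x \<in> L" "x \<in> L \<Longrightarrow> y \<in> L \<Longrightarrow> x - y \<in> L"
    "x \<in> L \<Longrightarrow> x \<in> carrier_vec n"
proof -
  show L: "L \<subseteq> carrier_vec n" "0\<^sub>v n \<in> L" "x \<in> L \<Longrightarrow> y \<in> L \<Longrightarrow> x + y \<in> L"
    "x \<in> L \<Longrightarrow> c \<cdot>\<^sub>v x \<in> L" "x \<in> L \<Longrightarrow> x \<in> carrier_vec n" for x y c
    using assms by (auto simp: linear_code_def)
  show "x - y \<in> L" if "x \<in> L" "y \<in> L"
  proof -
    have "x - y = x + (-1) \<cdot>\<^sub>v y"
      using that L(5) by (intro eq_vecI) (auto dest: L(5))
    thus ?thesis using L that by metis
  qed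
qed

lemma finite_linear_code: "linear_code n L \<Longrightarrow> finite (L :: 'a::{finite,field} vec set)"
  using finite_subset[OF linear_codeD(1) card_carrier_vec(2)] .

lemma card_linear_code_pos: "linear_code n L \<Longrightarrow> card (L :: 'a::{finite,field} vec set) > 0"
  using finite_linear_code linear_codeD(2) by (metis card_gt_0_iff empty_iff)

lemma linear_code_dual_code:
  assumes "L \<subseteq> carrier_vec n"
  shows "linear_code n (dual_code n L)"
  using assms unfolding linear_code_def dual_code_def
  by (auto simp: subset_iff add_scalar_prod_distrib[of _ n])

lemma linear_code_Int: "linear_code n L \<Longrightarrow> linear_code n M \<Longrightarrow> linear_code n (L \<inter> M)"
  by (auto simp: linear_code_def)

lemma dual_code_antimono: "L \<subseteq> M \<Longrightarrow> dual_code n M \<subseteq> dual_code n L"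
  by (auto simp: dual_code_def)

lemma dual_code_comm:
  "L \<subseteq> carrier_vec n \<Longrightarrow> M \<subseteq> carrier_vec n \<Longrightarrow> L \<subseteq> dual_code n M \<longleftrightarrow> M \<subseteq> dual_code n L"
  by (auto simp: dual_code_def subset_iff) (metis comm_scalar_prod)+

lemma linear_code_adjoin:
  assumes L: "linear_code n L" and e: "e \<in> carrier_vec n"
  shows "linear_code n (adjoin e L)" "L \<subseteq> adjoin e L" "e \<in> adjoin e L"
proof -
  note D = linear_codeD[OF L]
  have 1: "y + c \<cdot>\<^sub>v e \<in> adjoin e L" if "y \<in> L" for y c
    using that by (force simp: adjoin_def)
  show "L \<subseteq> adjoin e L"
  proof
    fix y assume y: "y \<in> L"
    have "y + 0 \<cdot>\<^sub>v e = y" using e D(6)[OF y] by (intro eq_vecI) auto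
    thus "y \<in> adjoin e L" using 1[OF y, of 0] by simp
  qed
  have "0\<^sub>v n + 1 \<cdot>\<^sub>v e = e" using e by simp
  thus "e \<in> adjoin e L" using 1[OF D(2), of 1] by simp
  show "linear_code n (adjoin e L)"
    unfolding linear_code_def
  proof (intro conjI ballI allI)
    show "adjoin e L \<subseteq> carrier_vec n" using D e by (auto simp: adjoin_def)
    show "0\<^sub>v n \<in> adjoin e L" using D \<open>L \<subseteq> adjoin e L\<close> by auto
  next
    fix x y assume "x \<in> adjoin e L" "y \<in> adjoin e L"
    then obtain a b c d where *: "a \<in> L" "b \<in> L" "x = a + c \<cdot>\<^sub>v e" "y = b + d \<cdot>\<^sub>v e"
      by (auto simp: adjoin_def)
    have "x + y = (a + b) + (c + d) \<cdot>\<^sub>v e"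
      using * e D(6)[of a] D(6)[of b] by (intro eq_vecI) (auto simp: algebra_simps)
    thus "x + y \<in> adjoin e L" using 1 D * by metis
  next
    fix x c assume "x \<in> adjoin e L"
    then obtain a d where *: "a \<in> L" "x = a + d \<cdot>\<^sub>v e"
      by (auto simp: adjoin_def)
    have "c \<cdot>\<^sub>v x = c \<cdot>\<^sub>v a + (c * d) \<cdot>\<^sub>v e"
      using * e D(6)[of a] by (intro eq_vecI) (auto simp: algebra_simps)
    thus "c \<cdot>\<^sub>v x \<in> adjoin e L" using 1 D * by metis
  qed
qed

text \<open>Two representations with different coefficients \<open>c\<close> and \<open>d\<close>
  would express \<open>e\<close> as a multiple of a difference of elements of
  \<open>L\<close>.\<close>

lemma card_adjoin:
  fixes L :: "'a::{finite,field} vec set"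
  assumes L: "linear_code n L" and e: "e \<in> carrier_vec n" "e \<notin> L"
  shows "card (adjoin e L) = CARD('a) * card L"
proof -
  note D = linear_codeD[OF L]
  have "inj_on (\<lambda>(c, y). y + c \<cdot>\<^sub>v e) (UNIV \<times> L)"
  proof (rule inj_onI, clarify)
    fix c d y z assume *: "y \<in> L" "z \<in> L" "y + c \<cdot>\<^sub>v e = z + d \<cdot>\<^sub>v e"
    have dim: "dim_vec y = n" "dim_vec z = n" "dim_vec e = n" using D * e by auto
    have idx: "y $ i + c * e $ i = z $ i + d * e $ i" if "i < n" for i
      using arg_cong[OF *(3), of "\<lambda>v. v $ i"] that dim by simp
    have "c = d"
    proof (rule ccontr)
      assume "c \<noteq> d"
      have "e = inverse (c - d) \<cdot>\<^sub>v (z - y)"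
        using dim \<open>c \<noteq> d\<close> idx by (intro eq_vecI) (auto simp: field_simps)
      thus False using e D * by metis
    qed
    moreover from this have "y = z" using idx dim by (intro eq_vecI) auto
    ultimately show "c = d \<and> y = z" by simp
  qed
  thus ?thesis unfolding adjoin_def by (simp add: card_image card_cartesian_product)
qed

lemma dual_code_adjoin:
  assumes L: "linear_code n L" and e: "e \<in> carrier_vec n"
  shows "dual_code n (adjoin e L) = {x \<in> dual_code n L. x \<bullet> e = 0}"
proof -
  note D = linear_codeD[OF L]
  have "x \<bullet> (y + c \<cdot>\<^sub>v e) = x \<bullet> y + c * (x \<bullet> e)" if "x \<in> carrier_vec n" "y \<in> L" for x y c
    using that e D by (simp add: scalar_prod_add_distrib[of _ n])
  hence "x \<in> dual_code n (adjoin e L)" if "x \<in> dual_code n L" "x \<bullet> e = 0" for x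
    using that by (auto simp: dual_code_def adjoin_def)
  thus ?thesis
    using linear_code_adjoin[OF L e] by (auto simp: dual_code_def)
qed

text \<open>The functional \<open>y \<mapsto> x \<bullet> y\<close> vanishes on \<open>L\<close>, or
  its kernel has index \<open>q\<close>, since the kernel and one vector outside it generate
  \<open>L\<close>. The factor \<open>CARD('a)\<close> avoids a division.\<close>

lemma card_linear_code_kernel:
  fixes L :: "'a::{finite,field} vec set"
  assumes L: "linear_code n L" and x: "x \<in> carrier_vec n"
  shows "CARD('a) * card {y\<in>L. x \<bullet> y = 0} =
    (if x \<in> dual_code n L then CARD('a) * card L else card L)"
proof (cases "x \<in> dual_code n L")
  case True
  hence "{y\<in>L. x \<bullet> y = 0} = L" by (auto simp: dual_code_def)
  thus ?thesis using True by simp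
next
  case False
  note D = linear_codeD[OF L]
  obtain e where e: "e \<in> L" "x \<bullet> e \<noteq> 0" using False x by (auto simp: dual_code_def)
  have ec: "e \<in> carrier_vec n" using e D by auto
  let ?M = "{y\<in>L. x \<bullet> y = 0}"
  have M: "linear_code n ?M"
    using L x unfolding linear_code_def by (auto simp: scalar_prod_add_distrib[of _ n] subset_iff)
  have "adjoin e ?M = L"
  proof
    show "adjoin e ?M \<subseteq> L" using D e by (auto simp: adjoin_def)
    show "L \<subseteq> adjoin e ?M"
    proof
      fix y assume y: "y \<in> L"
      \<comment> \<open>Subtracting this multiple of \<open>e\<close> moves \<open>y\<close> into
        the kernel.\<close>
      define c where "c = (x \<bullet> y) / (x \<bullet> e)"
      have yc: "y \<in> carrier_vec n" using y D by auto
      have "x \<bullet> (y - c \<cdot>\<^sub>v e) = 0"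
        using x yc ec e by (simp add: scalar_prod_minus_distrib[of _ n] c_def)
      hence "y - c \<cdot>\<^sub>v e \<in> ?M" using D y e by auto
      moreover have "y = (y - c \<cdot>\<^sub>v e) + c \<cdot>\<^sub>v e" using yc ec by (intro eq_vecI) auto
      ultimately show "y \<in> adjoin e ?M"
        unfolding adjoin_def by (intro image_eqI[of _ _ "(c, y - c \<cdot>\<^sub>v e)"]) auto
    qed
  qed
  moreover have "e \<notin> ?M" using e by simp
  ultimately show ?thesis using card_adjoin[OF M ec] False by simp
qed

lemma linear_code_carrier: "linear_code n (carrier_vec n)"
  by (auto simp: linear_code_def)

lemma dual_code_carrier: "dual_code n (carrier_vec n) = {0\<^sub>v n}"
proof -
  have "x = 0\<^sub>v n" if "x \<in> dual_code n (carrier_vec n)" for x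
  proof (rule eq_vecI)
    show "dim_vec x = dim_vec (0\<^sub>v n)" using that by (auto simp: dual_code_def)
    fix i assume i: "i < dim_vec (0\<^sub>v n)"
    have "x \<bullet> unit_vec n i = 0" using that by (auto simp: dual_code_def)
    thus "x $ i = 0\<^sub>v n $ i" using i that by (simp add: dual_code_def)
  qed
  thus ?thesis using linear_codeD(2)[OF linear_code_dual_code, of "carrier_vec n"] by auto
qed

text \<open>Double counting of the orthogonal pairs \<open>(x, y)\<close> with \<open>y \<in> L\<close>.\<close>

lemma card_mult_card_dual_code:
  fixes L :: "'a::{finite,field} vec set"
  assumes L: "linear_code n L"
  shows "card L * card (dual_code n L) = CARD('a) ^ n"
proof -
  let ?V = "carrier_vec n :: 'a vec set" and ?q = "CARD('a)"
  note D = linear_codeD[OF L]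
  note fin = card_carrier_vec(2)[of n, where 'a='a] finite_linear_code[OF L]
  have V: "linear_code n ?V" by (rule linear_code_carrier)
  have sub: "dual_code n L \<subseteq> ?V" by (auto simp: dual_code_def)
  have fd: "finite (dual_code n L)" using finite_subset[OF sub fin(1)] .
  have "(\<Sum>x\<in>?V. card {y\<in>L. x \<bullet> y = 0}) = (\<Sum>y\<in>L. card {x\<in>?V. x \<bullet> y = 0})"
    using fin by (rule sum_multicount_gen) simp
  also have "\<dots> = (\<Sum>y\<in>L. card {x\<in>?V. y \<bullet> x = 0})"
    using D by (intro sum.cong arg_cong[where f = card]) (auto simp: comm_scalar_prod[of _ n])
  finally have eq: "(\<Sum>x\<in>?V. ?q * card {y\<in>L. x \<bullet> y = 0}) = (\<Sum>y\<in>L. ?q * card {x\<in>?V. y \<bullet> x = 0})"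
    by (simp add: sum_distrib_left [symmetric])
  \<comment> \<open>Counted by \<open>x\<close>, each vector contributes \<open>card L\<close>, and
    each vector of the dual a further \<open>(q - 1) * card L\<close>. Counted by \<open>y\<close>,
    only \<open>y = 0\<close> is exceptional in this way.\<close>
  have "(\<Sum>x\<in>?V. ?q * card {y\<in>L. x \<bullet> y = 0})
      = (\<Sum>x\<in>?V. card L + (if x \<in> dual_code n L then (?q - 1) * card L else 0))"
    by (intro sum.cong) (auto simp: card_linear_code_kernel[OF L] algebra_simps)
  also have "\<dots> = ?q ^ n * card L + card (dual_code n L) * ((?q - 1) * card L)"
    using fin sub by (simp add: sum.distrib card_carrier_vec sum.If_cases Int_absorb1)
  finally have 1: "(\<Sum>x\<in>?V. ?q * card {y\<in>L. x \<bullet> y = 0}) = \<dots>" .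
  have "(\<Sum>y\<in>L. ?q * card {x\<in>?V. y \<bullet> x = 0})
      = (\<Sum>y\<in>L. ?q ^ n + (if y = 0\<^sub>v n then (?q - 1) * ?q ^ n else 0))"
    using D by (intro sum.cong)
      (auto simp: card_linear_code_kernel[OF V] dual_code_carrier card_carrier_vec algebra_simps)
  also have "\<dots> = ?q ^ n * card L + (?q - 1) * ?q ^ n"
    using fin D by (simp add: sum.distrib)
  finally have "(?q - 1) * (card L * card (dual_code n L)) = (?q - 1) * ?q ^ n"
    using eq 1 by (simp add: mult_ac)
  thus ?thesis using CARD_field_ge_2[where 'a='a] by simp
qed

text \<open>One inclusion is clear, and the cardinalities agree by
  \<open>card_mult_card_dual_code\<close> applied to \<open>L\<close> and to its dual.\<close>

lemma dual_code_dual_code: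
  fixes L :: "'a::{finite,field} vec set"
  assumes L: "linear_code n L"
  shows "dual_code n (dual_code n L) = L"
proof -
  note D = linear_codeD[OF L]
  have L': "linear_code n (dual_code n L)" using D by (intro linear_code_dual_code)
  have L'': "linear_code n (dual_code n (dual_code n L))"
    using linear_codeD(1)[OF L'] by (intro linear_code_dual_code)
  have "L \<subseteq> dual_code n (dual_code n L)"
    using dual_code_comm[of L n "dual_code n L"] D linear_codeD(1)[OF L'] by blast
  moreover have "card (dual_code n L) * card L = card (dual_code n L) * card (dual_code n (dual_code n L))"
    using card_mult_card_dual_code[OF L] card_mult_card_dual_code[OF L'] by (simp add: mult.commute)
  hence "card L = card (dual_code n (dual_code n L))"
    using card_linear_code_pos[OF L'] by simp
  ultimately show ?thesis
    using card_subset_eq[OF finite_linear_code[OF L'']] by metis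
qed

text \<open>A largest subcode whose order is a power of \<open>q\<close> is all of \<open>L\<close>,
  as adjoining a missing vector would multiply its order by \<open>q\<close>. The exponents are
  bounded because \<open>k < q ^ k\<close>.\<close>

lemma linear_code_card_power:
  fixes L :: "'a::{finite,field} vec set"
  assumes L: "linear_code n L"
  obtains k where "card L = CARD('a) ^ k"
proof -
  note D = linear_codeD[OF L]
  let ?P = "\<lambda>k. \<exists>M\<subseteq>L. linear_code n M \<and> card M = CARD('a) ^ k"
  have "linear_code n {0\<^sub>v n :: 'a vec}" by (auto simp: linear_code_def)
  hence P0: "?P 0" using D by (intro exI[of _ "{0\<^sub>v n}"]) auto
  have bound: "k \<le> card L" if "?P k" for k
  proof -
    have "k < CARD('a) ^ k" using CARD_field_ge_2[where 'a='a] by (intro power_gt_expt) auto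
    also have "\<dots> \<le> card L" using that card_mono[OF finite_linear_code[OF L]] by metis
    finally show ?thesis by simp
  qed
  obtain k where k: "?P k" "\<And>j. ?P j \<Longrightarrow> j \<le> k"
    using Nat.ex_has_greatest_nat[of ?P 0 "card L"] P0 bound by blast
  then obtain M where M: "M \<subseteq> L" "linear_code n M" "card M = CARD('a) ^ k" by blast
  have "M = L"
  proof (rule ccontr)
    assume "M \<noteq> L"
    then obtain e where e: "e \<in> L" "e \<notin> M" using M by blast
    have ec: "e \<in> carrier_vec n" using e D by auto
    have "adjoin e M \<subseteq> L" using e M D by (auto simp: adjoin_def)
    hence "?P (Suc k)"
      using linear_code_adjoin(1)[OF M(2) ec] card_adjoin[OF M(2) ec e(2)] M(3) by auto
    from k(2)[OF this] show False by simp
  qed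
  thus ?thesis using that M by blast
qed

section \<open>Subsystem codes from self-orthogonal codes\<close>

text \<open>
  The pair \<open>E\<^sub>1, E\<^sub>2\<close> represents the code \<open>X = E\<^sub>1 \<times> E\<^sub>2\<close> with \<open>Y = (E\<^sub>1 \<inter> E\<^sub>2\<^sup>\<bottom>) \<times> (E\<^sub>2 \<inter> E\<^sub>1\<^sup>\<bottom>)\<close>.
  Adjoining to \<open>E\<^sub>1\<close> a vector of \<open>E\<^sub>2\<^sup>\<bottom>\<close> enlarges \<open>Y\<close> by the same vector; adjoining a hyperbolic pair
  leaves \<open>Y\<close> unchanged.
\<close>

definition code_pair :: "'a::{finite,field} vec set \<Rightarrow> nat \<Rightarrow> nat \<Rightarrow> nat \<Rightarrow> nat \<Rightarrow>
    'a vec set \<Rightarrow> 'a vec set \<Rightarrow> bool" where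
  "code_pair D n s t r E1 E2 \<longleftrightarrow> linear_code n E1 \<and> linear_code n E2 \<and>
     D \<subseteq> E1 \<and> D \<subseteq> E2 \<and> D \<subseteq> dual_code n E1 \<and> D \<subseteq> dual_code n E2 \<and>
     card E1 = CARD('a) ^ (s + t + r) \<and> card E2 = CARD('a) ^ (s + r) \<and>
     card (E1 \<inter> dual_code n E2) = CARD('a) ^ (s + t) \<and>
     card (E2 \<inter> dual_code n E1) = CARD('a) ^ s"

text \<open>Supplies the vector to adjoin in both steps below. If the dual of \<open>E2\<close> lay
  inside \<open>E1\<close>, the product would be exactly \<open>q ^ n\<close>.\<close>

lemma dual_code_not_subset:
  fixes E1 E2 :: "'a::{finite,field} vec set"
  assumes "linear_code n E2" "card (E1 \<inter> dual_code n E2) * card E2 < CARD('a) ^ n"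
  shows "\<exists>e\<in>dual_code n E2. e \<notin> E1"
proof (rule ccontr)
  assume "\<not> ?thesis"
  hence "E1 \<inter> dual_code n E2 = dual_code n E2" by blast
  thus False using card_mult_card_dual_code[OF assms(1)] assms(2) by (simp add: mult.commute)
qed

lemma mem_adjoin: "x \<in> adjoin e L \<longleftrightarrow> (\<exists>c. \<exists>y\<in>L. x = y + c \<cdot>\<^sub>v e)"
  by (force simp: adjoin_def)

lemma code_pair_isotropic_step:
  fixes D :: "'a::{finite,field} vec set"
  assumes P: "code_pair D n s t r E1 E2" and less: "2 * s + t + r < n"
  shows "\<exists>E1'. code_pair D n s (Suc t) r E1' E2"
proof -
  have E: "linear_code n E1" "linear_code n E2" "D \<subseteq> E1" "D \<subseteq> E2"
      "D \<subseteq> dual_code n E1" "D \<subseteq> dual_code n E2"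
      "card E1 = CARD('a) ^ (s + t + r)" "card E2 = CARD('a) ^ (s + r)"
      "card (E1 \<inter> dual_code n E2) = CARD('a) ^ (s + t)"
      "card (E2 \<inter> dual_code n E1) = CARD('a) ^ s"
    using P by (auto simp: code_pair_def)
  have q: "CARD('a) > 1" using CARD_field_ge_2[where 'a='a] by simp
  \<comment> \<open>The exponents \<open>s + t\<close> and \<open>s + r\<close> add up to the left
    side of \<open>less\<close>.\<close>
  have "card (E1 \<inter> dual_code n E2) * card E2 < CARD('a) ^ n"
    using E(8,9) less q by (simp flip: power_add)
  then obtain e where e: "e \<in> dual_code n E2" "e \<notin> E1"
    using dual_code_not_subset E by blast
  have ec: "e \<in> carrier_vec n" using e by (auto simp: dual_code_def)
  note D1 = linear_codeD[OF E(1)] and D2 = linear_codeD[OF E(2)]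
  have L2: "linear_code n (dual_code n E2)" using D2 by (intro linear_code_dual_code)
  have L: "linear_code n (E1 \<inter> dual_code n E2)" by (rule linear_code_Int[OF E(1) L2])
  have orth: "x \<bullet> e = 0" if "x \<in> E2" for x
    using e that D2 ec by (simp add: dual_code_def comm_scalar_prod[of x n e])
  have d: "dual_code n (adjoin e E1) = {x \<in> dual_code n E1. x \<bullet> e = 0}"
    by (rule dual_code_adjoin[OF E(1) ec])
  \<comment> \<open>This is the modular law, applicable because \<open>e\<close> lies in the dual of
    \<open>E2\<close>.\<close>
  have "adjoin e E1 \<inter> dual_code n E2 = adjoin e (E1 \<inter> dual_code n E2)"
  proof (intro equalityI subsetI)
    fix x assume "x \<in> adjoin e E1 \<inter> dual_code n E2"
    then obtain c y where y: "y \<in> E1" "x = y + c \<cdot>\<^sub>v e" "x \<in> dual_code n E2"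
      by (auto simp: mem_adjoin)
    have "y = x - c \<cdot>\<^sub>v e" using y D1(6)[of y] ec by (intro eq_vecI) auto
    hence "y \<in> dual_code n E2" using linear_codeD(4,5)[OF L2] y(3) e(1) by metis
    thus "x \<in> adjoin e (E1 \<inter> dual_code n E2)" using y by (auto simp: mem_adjoin)
  next
    fix x assume "x \<in> adjoin e (E1 \<inter> dual_code n E2)"
    thus "x \<in> adjoin e E1 \<inter> dual_code n E2"
      using linear_codeD(3,4)[OF L2] e by (auto simp: mem_adjoin)
  qed
  hence "card (adjoin e E1 \<inter> dual_code n E2) = CARD('a) ^ (s + Suc t)"
    using card_adjoin[OF L ec] e E by simp
  moreover have "E2 \<inter> dual_code n (adjoin e E1) = E2 \<inter> dual_code n E1"
    using orth d by auto
  moreover have "D \<subseteq> dual_code n (adjoin e E1)"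
    using orth d E by auto
  moreover have "card (adjoin e E1) = CARD('a) ^ (s + Suc t + r)"
    using card_adjoin[OF E(1) ec e(2)] E by simp
  ultimately have "code_pair D n s (Suc t) r (adjoin e E1) E2"
    using E linear_code_adjoin[OF E(1) ec] by (auto simp: code_pair_def)
  thus ?thesis by blast
qed

lemma code_pair_hyperbolic_step:
  fixes D :: "'a::{finite,field} vec set"
  assumes P: "code_pair D n s t r E1 E2" and less: "2 * s + t + r < n"
  shows "\<exists>E1' E2'. code_pair D n s t (Suc r) E1' E2'"
proof -
  have E: "linear_code n E1" "linear_code n E2" "D \<subseteq> E1" "D \<subseteq> E2"
      "D \<subseteq> dual_code n E1" "D \<subseteq> dual_code n E2"
      "card E1 = CARD('a) ^ (s + t + r)" "card E2 = CARD('a) ^ (s + r)"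
      "card (E1 \<inter> dual_code n E2) = CARD('a) ^ (s + t)"
      "card (E2 \<inter> dual_code n E1) = CARD('a) ^ s"
    using P by (auto simp: code_pair_def)
  have q: "CARD('a) > 1" using CARD_field_ge_2[where 'a='a] by simp
  have "card (E1 \<inter> dual_code n E2) * card E2 < CARD('a) ^ n"
    using E(8,9) less q by (simp flip: power_add)
  then obtain e where e: "e \<in> dual_code n E2" "e \<notin> E1"
    using dual_code_not_subset E by blast
  have ec: "e \<in> carrier_vec n" using e by (auto simp: dual_code_def)
  note D1 = linear_codeD[OF E(1)] and D2 = linear_codeD[OF E(2)]
  have L1: "linear_code n (dual_code n E1)" using D1 by (intro linear_code_dual_code)
  \<comment> \<open>Since \<open>E1\<close> is its own double dual, \<open>e\<close> outside
    \<open>E1\<close> has a nonzero product with some \<open>g\<close> orthogonal to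
    \<open>E1\<close>. Scaling \<open>g\<close> gives the partner \<open>f\<close> with
    \<open>e \<bullet> f = 1\<close>.\<close>
  have "e \<notin> dual_code n (dual_code n E1)" using e dual_code_dual_code[OF E(1)] by simp
  then obtain g where g: "g \<in> dual_code n E1" "e \<bullet> g \<noteq> 0" using ec by (auto simp: dual_code_def)
  define f where "f = inverse (e \<bullet> g) \<cdot>\<^sub>v g"
  have f: "f \<in> dual_code n E1" using g linear_codeD(4)[OF L1] by (simp add: f_def)
  have fc: "f \<in> carrier_vec n" using f by (auto simp: dual_code_def)
  have "g \<in> carrier_vec n" using g by (auto simp: dual_code_def)
  hence ef: "e \<bullet> f = 1" using g ec by (simp add: f_def)
  hence fe: "f \<bullet> e = 1" using ec fc by (simp add: comm_scalar_prod[of f n e])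
  have orth2: "x \<bullet> e = 0" "e \<bullet> x = 0" if "x \<in> E2" for x
    using e that D2(6)[of x] ec by (simp_all add: dual_code_def comm_scalar_prod[of x n e])
  have orth1: "x \<bullet> f = 0" "f \<bullet> x = 0" if "x \<in> E1" for x
    using f that D1(6)[of x] fc by (simp_all add: dual_code_def comm_scalar_prod[of x n f])
  have f2: "f \<notin> E2" using orth2 ef by force
  have d1: "dual_code n (adjoin e E1) = {x \<in> dual_code n E1. x \<bullet> e = 0}"
    by (rule dual_code_adjoin[OF E(1) ec])
  have d2: "dual_code n (adjoin f E2) = {x \<in> dual_code n E2. x \<bullet> f = 0}"
    by (rule dual_code_adjoin[OF E(2) fc])
  have "adjoin e E1 \<inter> dual_code n (adjoin f E2) = E1 \<inter> dual_code n E2"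
  proof (intro equalityI subsetI)
    fix x assume "x \<in> adjoin e E1 \<inter> dual_code n (adjoin f E2)"
    then obtain c y where y: "y \<in> E1" "x = y + c \<cdot>\<^sub>v e" "x \<in> dual_code n E2" "x \<bullet> f = 0"
      by (auto simp: mem_adjoin d2)
    \<comment> \<open>The product with \<open>f\<close> reads off the coefficient of
      \<open>e\<close>, because \<open>f\<close> is orthogonal to \<open>E1\<close>. Orthogonality
      to \<open>f\<close> therefore forces \<open>c = 0\<close>; the other intersection is
      symmetric.\<close>
    have "x \<bullet> f = c"
      using y D1(6)[of y] ec fc ef orth1 by (simp add: add_scalar_prod_distrib[of _ n])
    hence "x = y" using y D1(6)[of y] ec by auto
    thus "x \<in> E1 \<inter> dual_code n E2" using y by simp
  next
    fix x assume "x \<in> E1 \<inter> dual_code n E2"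
    thus "x \<in> adjoin e E1 \<inter> dual_code n (adjoin f E2)"
      using linear_code_adjoin[OF E(1) ec] orth1 by (auto simp: d2)
  qed
  moreover have "adjoin f E2 \<inter> dual_code n (adjoin e E1) = E2 \<inter> dual_code n E1"
  proof (intro equalityI subsetI)
    fix x assume "x \<in> adjoin f E2 \<inter> dual_code n (adjoin e E1)"
    then obtain c y where y: "y \<in> E2" "x = y + c \<cdot>\<^sub>v f" "x \<in> dual_code n E1" "x \<bullet> e = 0"
      by (auto simp: mem_adjoin d1)
    have "x \<bullet> e = c"
      using y D2(6)[of y] ec fc fe orth2 by (simp add: add_scalar_prod_distrib[of _ n])
    hence "x = y" using y D2(6)[of y] fc by auto
    thus "x \<in> E2 \<inter> dual_code n E1" using y by simp
  next
    fix x assume "x \<in> E2 \<inter> dual_code n E1"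
    thus "x \<in> adjoin f E2 \<inter> dual_code n (adjoin e E1)"
      using linear_code_adjoin[OF E(2) fc] orth2 by (auto simp: d1)
  qed
  moreover have "D \<subseteq> dual_code n (adjoin e E1)" "D \<subseteq> dual_code n (adjoin f E2)"
    using orth1 orth2 d1 d2 E by auto
  ultimately have "code_pair D n s t (Suc r) (adjoin e E1) (adjoin f E2)"
    using E linear_code_adjoin[OF E(1) ec] linear_code_adjoin[OF E(2) fc]
      card_adjoin[OF E(1) ec e(2)] card_adjoin[OF E(2) fc f2]
    by (simp add: code_pair_def) blast
  thus ?thesis by blast
qed

text \<open>The start is \<open>E1 = E2 = D\<close>. With \<open>r = 0\<close>, \<open>t\<close>
  isotropic steps come first, then \<open>r\<close> hyperbolic ones; each step raises
  \<open>2 * s + t + r\<close> by one.\<close>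

lemma exists_code_pair:
  fixes D :: "'a::{finite,field} vec set"
  assumes D: "linear_code n D" "D \<subseteq> dual_code n D" "card D = CARD('a) ^ s"
    and le: "2 * s + t + r \<le> n"
  shows "\<exists>E1 E2. code_pair D n s t r E1 E2"
  using le
proof (induction r)
  case 0
  thus ?case
  proof (induction t)
    case 0
    have "code_pair D n s 0 0 D D"
      using D by (auto simp: code_pair_def Int_absorb2)
    thus ?case by blast
  next
    case (Suc t)
    then obtain E1 E2 where "code_pair D n s t 0 E1 E2" by auto
    from code_pair_isotropic_step[OF this] show ?case using Suc.prems by auto
  qed
next
  case (Suc r)
  then obtain E1 E2 where "code_pair D n s t r E1 E2" by auto
  from code_pair_hyperbolic_step[OF this] show ?case using Suc.prems by auto
qed

section \<open>Symplectic duals of product codes and the resulting subsystem codes\<close>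

lemma symp_dual_Times:
  fixes E1 E2 :: "'a::{finite,field} vec set"
  assumes E1: "linear_code n E1" and E2: "linear_code n E2"
  shows "symp_dual n (E1 \<times> E2) = dual_code n E2 \<times> dual_code n E1"
proof (intro equalityI subsetI)
  fix v assume "v \<in> symp_dual n (E1 \<times> E2)"
  then obtain a b where v: "v = (a, b)" "a \<in> carrier_vec n" "b \<in> carrier_vec n"
    and tr: "\<And>x y. x \<in> E1 \<Longrightarrow> y \<in> E2 \<Longrightarrow> abs_trace (x \<bullet> b - a \<bullet> y) = 0"
    by (cases v) (auto simp: symp_dual_def trace_symp_def)
  obtain z :: 'a where z: "abs_trace z \<noteq> 0" using abs_trace_nontrivial by blast
  have "b \<bullet> x = 0" if x: "x \<in> E1" for x
  proof (rule ccontr)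
    assume nz: "b \<bullet> x \<noteq> 0"
    have xc: "x \<in> carrier_vec n" using x linear_codeD[OF E1] by auto
    \<comment> \<open>\<open>E1\<close> is closed under scalars, so a nonzero inner product can be
      scaled to the element \<open>z\<close> of nonzero trace. Pairing with
      \<open>0\<^sub>v n\<close> in the other half isolates one inner product.\<close>
    let ?c = "z / (x \<bullet> b)"
    have "(?c \<cdot>\<^sub>v x) \<bullet> b - a \<bullet> 0\<^sub>v n = z"
      using nz xc v by (simp add: comm_scalar_prod[of b n x])
    thus False
      using tr[of "?c \<cdot>\<^sub>v x" "0\<^sub>v n"] x z linear_codeD(4)[OF E1] linear_codeD(2)[OF E2] by auto
  qed
  moreover have "a \<bullet> y = 0" if y: "y \<in> E2" for y
  proof (rule ccontr)
    assume nz: "a \<bullet> y \<noteq> 0"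
    have yc: "y \<in> carrier_vec n" using y linear_codeD[OF E2] by auto
    let ?c = "- z / (a \<bullet> y)"
    have "0\<^sub>v n \<bullet> b - a \<bullet> (?c \<cdot>\<^sub>v y) = z"
      using nz yc v by simp
    thus False
      using tr[of "0\<^sub>v n" "?c \<cdot>\<^sub>v y"] y z linear_codeD(4)[OF E2] linear_codeD(2)[OF E1] by auto
  qed
  ultimately show "v \<in> dual_code n E2 \<times> dual_code n E1" using v by (auto simp: dual_code_def)
next
  fix v assume "v \<in> dual_code n E2 \<times> dual_code n E1"
  then obtain a b where v: "v = (a, b)" "a \<in> dual_code n E2" "b \<in> dual_code n E1" by auto
  have "x \<bullet> b = 0" if "x \<in> E1" for x
    using v that linear_codeD(6)[OF E1 that] by (auto simp: dual_code_def comm_scalar_prod[of x n])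
  thus "v \<in> symp_dual n (E1 \<times> E2)"
    using v by (auto simp: symp_dual_def trace_symp_def dual_code_def abs_trace_0)
qed

lemma subgroup_linear_code:
  assumes "linear_code n L"
  shows "subgroup L (monoid_vec TYPE('a::field) n)"
proof -
  interpret G: comm_group "monoid_vec TYPE('a) n" by (rule comm_group_vec)
  note D = linear_codeD[OF assms]
  show ?thesis
  proof (rule G.subgroupI)
    fix x assume x: "x \<in> L"
    have "(-1) \<cdot>\<^sub>v x + x = 0\<^sub>v n" using D(6)[OF x] by (intro eq_vecI) auto
    hence "inv\<^bsub>monoid_vec TYPE('a) n\<^esub> x = (-1) \<cdot>\<^sub>v x"
      using D(6)[OF x] by (intro G.inv_equality) (auto simp: monoid_vec_simps)
    thus "inv\<^bsub>monoid_vec TYPE('a) n\<^esub> x \<in> L" using D x by simp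
  qed (use D in \<open>auto simp: monoid_vec_simps\<close>)
qed

lemma exists_subsystem_code_if_self_orthogonal:
  fixes D :: "'a::{finite,field} vec set"
  assumes D: "linear_code n D" "D \<subseteq> dual_code n D" "card D \<le> CARD('a) ^ s"
    and dist: "\<And>x. x \<in> dual_code n D \<Longrightarrow> x \<noteq> 0\<^sub>v n \<Longrightarrow> \<delta> \<le> card {i. i < n \<and> x $ i \<noteq> 0}"
    and less: "2 * s + r < n"
  shows "\<exists>d\<ge>\<delta>. exists_subsystem_code TYPE('a) n (n - 2 * s - r) r d"
proof -
  let ?q = "CARD('a)"
  have q: "?q > 1" using CARD_field_ge_2[where 'a='a] by simp
  obtain s0 where s0: "card D = ?q ^ s0" using linear_code_card_power[OF D(1)] .
  have "s0 \<le> s" using D(3) s0 q by simp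
  \<comment> \<open>With this choice \<open>Y\<close> has order
    \<open>q ^ (2 * s0 + t) = q ^ (2 * s)\<close>, whatever the true dimension \<open>s0\<close> of
    \<open>D\<close> is.\<close>
  define t where "t = 2 * (s - s0)"
  have "2 * s0 + t + r \<le> n" using less \<open>s0 \<le> s\<close> by (simp add: t_def)
  then obtain E1 E2 where P: "code_pair D n s0 t r E1 E2"
    using exists_code_pair[OF D(1,2) s0] by blast
  hence E: "linear_code n E1" "linear_code n E2" "D \<subseteq> E1" "D \<subseteq> E2"
      "D \<subseteq> dual_code n E1" "D \<subseteq> dual_code n E2"
      "card E1 = ?q ^ (s0 + t + r)" "card E2 = ?q ^ (s0 + r)"
      "card (E1 \<inter> dual_code n E2) = ?q ^ (s0 + t)"
      "card (E2 \<inter> dual_code n E1) = ?q ^ s0"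
    by (auto simp: code_pair_def)
  define A where "A = E1 \<inter> dual_code n E2"
  define B where "B = E2 \<inter> dual_code n E1"
  have lin: "linear_code n A" "linear_code n B"
    unfolding A_def B_def using E(1,2) linear_codeD(1)
    by (auto intro!: linear_code_Int linear_code_dual_code)
  \<comment> \<open>The strict inequality \<open>2 * s + r < n\<close> yields \<open>e\<close> with
    \<open>(e, 0\<^sub>v n)\<close> in the dual of \<open>Y\<close> but not in \<open>W\<close>.
    This rules out the case \<open>K = 1\<close> and makes the minimum one over a nonempty
    set.\<close>
  have "card A * card E2 < ?q ^ n"
    using E(8,9) less q \<open>s0 \<le> s\<close> by (simp add: A_def t_def flip: power_add)
  then obtain e where e: "e \<in> dual_code n E2" "e \<notin> E1"
    using dual_code_not_subset[OF E(2)] unfolding A_def by blast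
  define W where "W = E1 \<times> E2"
  define Y where "Y = W \<inter> symp_dual n W"
  define k where "k = n - 2 * s - r"
  have Y: "Y = A \<times> B" by (auto simp: Y_def W_def symp_dual_Times[OF E(1,2)] A_def B_def)
  have Yd: "symp_dual n Y = dual_code n B \<times> dual_code n A"
    unfolding Y by (rule symp_dual_Times[OF lin])
  have "B \<subseteq> E2" by (simp add: B_def)
  hence "e \<in> dual_code n B" using e dual_code_antimono by blast
  moreover have "0\<^sub>v n \<in> dual_code n A"
    using lin linear_codeD(1) by (intro linear_codeD(2) linear_code_dual_code) auto
  ultimately have w: "(e, 0\<^sub>v n) \<in> symp_dual n Y - W"
    using e by (simp add: Yd W_def)
  have W0: "(0\<^sub>v n, 0\<^sub>v n) \<in> W" using E by (simp add: W_def linear_codeD(2))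
  \<comment> \<open>Both factors \<open>A\<close> and \<open>B\<close> contain \<open>D\<close>, so
    their duals lie in the dual of \<open>D\<close>.\<close>
  have dual_sub: "symp_dual n Y \<subseteq> dual_code n D \<times> dual_code n D"
    unfolding Yd A_def B_def using E dual_code_antimono[of D] by (intro Sigma_mono) auto
  have dim: "s0 + t + r + (s0 + r) + k = n + r" "s0 + t + s0 + k + r = n"
    using less \<open>s0 \<le> s\<close> by (auto simp: k_def t_def)
  have sub: "subgroup W (symp_group TYPE('a) n)"
    unfolding W_def
    by (intro DirProd_subgroups subgroup_linear_code E comm_group.axioms(2) comm_group_vec)
  have "card W * ?q ^ k = ?q ^ n * ?q ^ r"
    by (simp only: W_def card_cartesian_product E(7,8) dim(1) power_add [symmetric])
  hence "real (card W) * real ?q ^ k = real ?q ^ n * real ?q ^ r"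
    by (metis of_nat_mult of_nat_power)
  hence cW: "real (card W) = real ?q ^ n * real (?q ^ r) / real (?q ^ k)"
    using q by (simp add: field_simps)
  have "card Y * ?q ^ k * ?q ^ r = ?q ^ n"
    using dim(2) E(9,10) by (simp add: Y card_cartesian_product A_def B_def flip: power_add)
  hence "real (card Y) * real ?q ^ k * real ?q ^ r = real ?q ^ n"
    by (metis of_nat_mult of_nat_power)
  hence cY: "real (card Y) = real ?q ^ n / (real (?q ^ k) * real (?q ^ r))"
    using q by (simp add: field_simps)
  have pos: "1 \<le> ?q ^ k" "1 \<le> ?q ^ r" using q by simp_all
  have "exists_subsystem_code TYPE('a) n k r (min_swt n (symp_dual n Y - W))"
    unfolding exists_subsystem_code_def exists_subsystem_code_dims_def
  proof (rule conjI[OF pos(1)], rule conjI[OF pos(2)], rule exI[of _ W], rule exI[of _ Y],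
      intro conjI)
    have "symp_dual n Y \<noteq> W" using w by blast
    thus "min_swt n (symp_dual n Y - W) = (if symp_dual n Y \<noteq> W
        then min_swt n (symp_dual n Y - W) else min_swt n (symp_dual n Y))" by simp
  qed (use sub cW cY Y_def in auto)
  moreover have "\<delta> \<le> min_swt n (symp_dual n Y - W)"
    unfolding min_swt_def
  proof (rule Min.boundedI)
    have "finite (dual_code n D)"
      using D linear_codeD(1) by (intro finite_linear_code[of n] linear_code_dual_code) auto
    thus "finite (swt n ` (symp_dual n Y - W - {(0\<^sub>v n, 0\<^sub>v n)}))"
      using dual_sub by (meson finite_Diff finite_SigmaI finite_imageI finite_subset)
    have "(e, 0\<^sub>v n) \<noteq> (0\<^sub>v n, 0\<^sub>v n)" using w W0 by auto
    thus "swt n ` (symp_dual n Y - W - {(0\<^sub>v n, 0\<^sub>v n)}) \<noteq> {}" using w by blast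
  next
    fix d assume "d \<in> swt n ` (symp_dual n Y - W - {(0\<^sub>v n, 0\<^sub>v n)})"
    then obtain a b where ab: "a \<in> dual_code n D" "b \<in> dual_code n D"
        "a \<noteq> 0\<^sub>v n \<or> b \<noteq> 0\<^sub>v n" "d = swt n (a, b)"
      using dual_sub by auto
    \<comment> \<open>The symplectic weight dominates the Hamming weight of each half, and at least
      one half is nonzero.\<close>
    have "card {i. i < n \<and> a $ i \<noteq> 0} \<le> d" "card {i. i < n \<and> b $ i \<noteq> 0} \<le> d"
      using ab(4) by (auto simp: swt_def intro!: card_mono)
    thus "\<delta> \<le> d" using dist ab by (meson order.trans)
  qed
  ultimately show ?thesis unfolding k_def by blast
qed

section \<open>BCH codes\<close>

text \<open>Divisibility would mean that \<open>-b\<close> lies in the cyclotomic coset of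
  \<open>a\<close> modulo \<open>q ^ m - 1\<close>. For \<open>i \<le> m div 2\<close> the sum is
  positive and smaller than the modulus; larger \<open>i\<close> reduce to
  \<open>m - i\<close>.\<close>

lemma not_dvd_cyclotomic_sum:
  fixes q m k a b i :: nat
  assumes k: "k * (q ^ (m div 2) + 1) < q ^ m - 1"
    and ab: "1 \<le> a" "a \<le> k" "1 \<le> b" "b \<le> k" and i: "i < m"
  shows "\<not> (q ^ m - 1) dvd (a * q ^ i + b)"
proof -
  have q: "q \<ge> 1" using k i by (cases q) (auto simp: power_0_left)
  have small: "\<not> (q ^ m - 1) dvd (c * q ^ j + d)"
    if "1 \<le> d" "c \<le> k" "d \<le> k" "j \<le> m div 2" for c d j
  proof -
    have "c * q ^ j + d \<le> k * q ^ (m div 2) + k"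
      using that q by (intro add_mono mult_mono power_increasing) auto
    also have "\<dots> < q ^ m - 1" using k by (simp add: algebra_simps)
    finally show ?thesis using that by (auto dest: dvd_imp_le)
  qed
  show ?thesis
  proof (cases "i \<le> m div 2")
    case True
    thus ?thesis using small ab by blast
  next
    case False
    hence le: "m - i \<le> m div 2" by linarith
    \<comment> \<open>Multiplication by \<open>q ^ (m - i)\<close> exchanges the roles of \<open>a\<close> and \<open>b\<close> modulo \<open>q ^ m - 1\<close>.\<close>
    have "q ^ m = (q ^ m - 1) + 1" using q by simp
    moreover have "q ^ (m - i) * (a * q ^ i + b) = a * q ^ m + b * q ^ (m - i)"
      using i by (simp add: algebra_simps flip: power_add)
    ultimately have eq: "q ^ (m - i) * (a * q ^ i + b) = a * (q ^ m - 1) + (b * q ^ (m - i) + a)"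
      by (metis add.assoc add.commute distrib_left mult.right_neutral)
    show ?thesis
    proof
      assume "(q ^ m - 1) dvd (a * q ^ i + b)"
      hence "(q ^ m - 1) dvd a * (q ^ m - 1) + (b * q ^ (m - i) + a)"
        using eq by (metis dvd_mult)
      hence "(q ^ m - 1) dvd (b * q ^ (m - i) + a)"
        by (simp add: dvd_add_right_iff)
      thus False using small[of a b "m - i"] ab le by simp
    qed
  qed
qed

text \<open>The power of \<open>q\<close> vanishes in the field, so the value is \<open>-1\<close>.
  This makes \<open>X ^ n - 1\<close> separable.\<close>

lemma of_nat_card_power_minus_1_nonzero:
  assumes "m \<ge> 1"
  shows "of_nat (CARD('a::{finite,field}) ^ m - 1) \<noteq> (0 :: 'a alg_closure)"
proof -
  obtain e where e: "CARD('a) = CHAR('a) ^ e" using card_field_eq_CHAR_power by blast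
  hence "e \<noteq> 0" using CARD_field_ge_2[where 'a='a] by (intro notI) simp
  hence "CHAR('a) dvd CARD('a) ^ m" using e assms by (simp flip: power_mult)
  moreover have "CARD('a) ^ m = Suc (CARD('a) ^ m - 1)" by simp
  ultimately have "of_nat (Suc (CARD('a) ^ m - 1)) = (0 :: 'a alg_closure)"
    by (metis of_nat_eq_0_iff_char_dvd CHAR_alg_closure)
  thus ?thesis by (metis add.right_neutral of_nat_Suc one_neq_zero)
qed

text \<open>\<open>\<beta>\<close> lists the \<open>n\<close>-th roots of unity in an arbitrary
  order, and coordinate \<open>i\<close> of a word belongs to the root \<open>\<beta> i\<close>. The
  usual cyclic order is \<open>\<beta> i = \<alpha> ^ i\<close> with \<open>\<alpha>\<close>
  primitive.\<close>

locale bch =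
  fixes m n :: nat and \<beta> :: "nat \<Rightarrow> 'a::{finite,field} alg_closure"
  assumes m_pos: "m \<ge> 1" and n_eq: "n = CARD('a) ^ m - 1"
    and \<beta>: "bij_betw \<beta> {..<n} {x. x ^ n = 1}"
begin

text \<open>The subfield with \<open>q ^ m\<close> elements.\<close>

definition ext :: "'a alg_closure set" where
  "ext = insert 0 {x. x ^ n = 1}"

text \<open>On \<open>ext\<close> this is the relative trace onto the copy of \<open>F_q\<close> in
  the closure.\<close>

definition tr :: "'a alg_closure \<Rightarrow> 'a alg_closure" where
  "tr x = (\<Sum>u<m. x ^ (CARD('a) ^ u))"

text \<open>For \<open>\<beta> i = \<alpha> ^ i\<close>, the value at \<open>\<alpha> ^ b\<close> of
  the polynomial with coefficients \<open>v\<close>.\<close>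

definition syndrome :: "'a vec \<Rightarrow> nat \<Rightarrow> 'a alg_closure" where
  "syndrome v b = (\<Sum>i<n. to_ac (v $ i) * \<beta> i ^ b)"

text \<open>For coefficients in \<open>ext\<close> the trace lies in the image of
  \<open>F_q\<close>, where \<open>of_ac\<close> inverts the embedding \<open>to_ac\<close>.\<close>

definition trace_word :: "nat set \<Rightarrow> (nat \<Rightarrow> 'a alg_closure) \<Rightarrow> 'a vec" where
  "trace_word T c = vec n (\<lambda>i. of_ac (tr (\<Sum>a\<in>T. c a * \<beta> i ^ a)))"

text \<open>By Delsarte's theorem this is the dual of the code with zeros \<open>\<alpha>\<^sup>a\<close> for \<open>a \<in> T\<close>.\<close>

definition trace_code :: "nat set \<Rightarrow> 'a vec set" where
  "trace_code T = trace_word T ` (T \<rightarrow>\<^sub>E ext)"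

lemma q_power_m: "CARD('a) ^ m = Suc n"
  unfolding n_eq by simp

lemma n_pos: "n > 0"
  using power_gt_expt[of "CARD('a)" m] CARD_field_ge_2[where 'a='a] m_pos q_power_m by simp

lemma of_nat_n_nonzero: "of_nat n \<noteq> (0 :: 'a alg_closure)"
  unfolding n_eq by (rule of_nat_card_power_minus_1_nonzero[OF m_pos])

lemma frobenius_sum:
  fixes f :: "'b \<Rightarrow> 'a alg_closure"
  shows "sum f A ^ (CARD('a) ^ u) = (\<Sum>i\<in>A. f i ^ (CARD('a) ^ u))"
proof -
  obtain e where e: "CARD('a) = CHAR('a) ^ e" using card_field_eq_CHAR_power by blast
  have "Factorial_Ring.prime CHAR('a alg_closure)"
    using finite_imp_CHAR_pos[where 'a='a, OF finite] prime_CHAR_semidom[where 'a='a] by simp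
  thus ?thesis
    by (rule freshmans_dream_sum'[where n = "e * u"]) (simp add: e power_mult)
qed

lemma frobenius_add:
  "(x + y :: 'a alg_closure) ^ (CARD('a) ^ u) = x ^ (CARD('a) ^ u) + y ^ (CARD('a) ^ u)"
  using frobenius_sum[of "\<lambda>b. if b then x else y" UNIV u] by (simp add: UNIV_bool add.commute)

text \<open>In this form, closure under the field operations follows from additivity and
  multiplicativity of the Frobenius map.\<close>

lemma ext_iff: "x \<in> ext \<longleftrightarrow> x ^ (CARD('a) ^ m) = x"
  using n_pos by (auto simp: ext_def q_power_m)

lemma finite_ext: "finite ext" and card_ext: "card ext = CARD('a) ^ m"
  using card_nth_roots_of_unity[OF of_nat_n_nonzero] n_pos
  by (auto simp: ext_def q_power_m power_0_left)

lemma ext_0: "0 \<in> ext" by (simp add: ext_def)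

lemma ext_add: "x \<in> ext \<Longrightarrow> y \<in> ext \<Longrightarrow> x + y \<in> ext"
  by (simp add: ext_iff frobenius_add)

lemma ext_sum: "(\<And>i. i \<in> A \<Longrightarrow> f i \<in> ext) \<Longrightarrow> sum f A \<in> ext"
  by (simp add: ext_iff frobenius_sum)

lemma ext_mult: "x \<in> ext \<Longrightarrow> y \<in> ext \<Longrightarrow> x * y \<in> ext"
  by (simp add: ext_iff power_mult_distrib)

lemma ext_power: "x \<in> ext \<Longrightarrow> x ^ k \<in> ext"
proof -
  assume "x \<in> ext"
  moreover have "(x ^ k) ^ (CARD('a) ^ m) = (x ^ (CARD('a) ^ m)) ^ k"
    by (simp only: power_mult [symmetric] mult.commute)
  ultimately show ?thesis by (simp add: ext_iff)
qed

lemma ext_divide: "x \<in> ext \<Longrightarrow> y \<in> ext \<Longrightarrow> x / y \<in> ext"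
  by (simp add: ext_iff power_divide)

lemma to_ac_power_q: "to_ac (x :: 'a) ^ (CARD('a) ^ u) = to_ac x"
  by (metis finite_field_power_card_power to_ac_power)

lemma ext_to_ac: "to_ac x \<in> ext"
  by (simp add: ext_iff to_ac_power_q)

lemma \<beta>_root: "i < n \<Longrightarrow> \<beta> i ^ n = 1"
  using bij_betwE[OF \<beta>] by simp

lemma \<beta>_ext: "i < n \<Longrightarrow> \<beta> i \<in> ext"
  by (simp add: ext_def \<beta>_root)

lemma \<beta>_nonzero: "i < n \<Longrightarrow> \<beta> i \<noteq> 0"
  using \<beta>_root[of i] n_pos by (auto simp: power_0_left)

text \<open>\<open>X ^ q - X\<close> has at most \<open>q\<close> roots, and the image of
  \<open>F_q\<close> already supplies that many.\<close>

lemma range_to_ac: "x ^ CARD('a) = x \<Longrightarrow> x \<in> range (to_ac :: 'a \<Rightarrow> _)"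
proof -
  let ?q = "CARD('a)"
  define P :: "'a alg_closure poly" where "P = Polynomial.monom 1 ?q + [:0, -1:]"
  have q: "?q \<ge> 2" by (rule CARD_field_ge_2)
  have deg: "Polynomial.degree P = ?q"
    unfolding P_def using q by (subst degree_add_eq_left) (auto simp: degree_monom_eq)
  hence P: "P \<noteq> 0" using q by auto
  have sub: "range (to_ac :: 'a \<Rightarrow> _) \<subseteq> {x. poly P x = 0}"
    using to_ac_power_q[of _ 1] by (auto simp: P_def poly_monom)
  have "card (range (to_ac :: 'a \<Rightarrow> _)) = ?q" by (simp add: card_image inj_to_ac)
  hence "range (to_ac :: 'a \<Rightarrow> _) = {x. poly P x = 0}"
    using card_poly_roots_bound[OF P] deg
    by (intro card_seteq[OF poly_roots_finite[OF P] sub]) auto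
  moreover assume "x ^ ?q = x"
  ultimately show ?thesis by (auto simp: P_def poly_monom)
qed

lemma tr_sum: "tr (sum f A) = (\<Sum>i\<in>A. tr (f i))"
  unfolding tr_def frobenius_sum by (rule sum.swap)

lemma tr_add: "tr (x + y) = tr x + tr y"
  by (simp add: tr_def frobenius_add sum.distrib)

lemma tr_0: "tr 0 = 0"
  by (simp add: tr_def power_0_left)

lemma tr_to_ac_mult: "tr (to_ac c * x) = to_ac c * tr x"
  by (simp add: tr_def power_mult_distrib to_ac_power_q sum_distrib_left)

text \<open>Raising to the power \<open>q\<close> shifts the summands of the trace cyclically, as
  \<open>x ^ (q ^ m) = x\<close>, so the trace is fixed by Frobenius.\<close>

lemma to_ac_of_ac_tr:
  assumes "x \<in> ext"
  shows "to_ac (of_ac (tr x) :: 'a) = tr x"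
proof -
  have "tr x ^ CARD('a) = (\<Sum>u<m. x ^ (CARD('a) ^ Suc u))"
    unfolding tr_def using frobenius_sum[of "\<lambda>u. x ^ (CARD('a) ^ u)" "{..<m}" 1]
    by (simp add: mult.commute flip: power_mult)
  also have "\<dots> + x = (\<Sum>u<Suc m. x ^ (CARD('a) ^ u))"
    by (subst sum.lessThan_Suc_shift) simp
  also have "\<dots> = tr x + x" using assms by (simp add: tr_def ext_iff)
  finally show ?thesis by (intro to_ac_of_ac range_to_ac) simp
qed

lemma tr_nondegenerate:
  assumes "s \<in> ext" "\<And>x. x \<in> ext \<Longrightarrow> tr (x * s) = 0"
  shows "s = 0"
proof (rule ccontr)
  assume "s \<noteq> 0"
  obtain x where x: "x \<in> ext" "tr x \<noteq> 0"
    using linearized_sum_nonzero[OF finite_ext card_ext CARD_field_ge_2 m_pos]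
    by (auto simp: tr_def)
  thus False using assms(2)[of "x / s"] ext_divide[OF x(1) assms(1)] \<open>s \<noteq> 0\<close> by simp
qed

section \<open>Syndromes and the duals of trace codes\<close>

lemma syndrome_ext: "syndrome v b \<in> ext"
  unfolding syndrome_def by (intro ext_sum ext_mult ext_to_ac ext_power \<beta>_ext) auto

text \<open>Frobenius fixes the coordinates of \<open>v\<close>. Vanishing at \<open>b\<close> thus
  forces vanishing at \<open>q * b\<close>, which is why \<open>T\<close> can omit the multiples of
  \<open>q\<close>.\<close>

lemma syndrome_mult_q: "syndrome v (CARD('a) * b) = syndrome v b ^ CARD('a)"
  using frobenius_sum[of "\<lambda>i. to_ac (v $ i) * \<beta> i ^ b" "{..<n}" 1]
    to_ac_power_q[of _ 1]
  by (simp add: syndrome_def power_mult_distrib mult.commute flip: power_mult)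

lemma trace_word_ext:
  "c \<in> T \<rightarrow> ext \<Longrightarrow> i < n \<Longrightarrow> (\<Sum>a\<in>T. c a * \<beta> i ^ a) \<in> ext"
  by (intro ext_sum ext_mult ext_power \<beta>_ext) auto

lemma to_ac_trace_word:
  "c \<in> T \<rightarrow> ext \<Longrightarrow> i < n \<Longrightarrow> to_ac (trace_word T c $ i) = tr (\<Sum>a\<in>T. c a * \<beta> i ^ a)"
  by (simp add: trace_word_def to_ac_of_ac_tr trace_word_ext)

lemma trace_word_carrier: "trace_word T c \<in> carrier_vec n"
  by (simp add: trace_word_def)

lemma trace_word_restrict: "trace_word T (restrict c T) = trace_word T c"
  by (simp add: trace_word_def cong: sum.cong)

text \<open>Extensional functions suit counting; arbitrary ones suit pointwise operations on
  coefficients.\<close>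

lemma trace_code_eq: "trace_code T = trace_word T ` (T \<rightarrow> ext)"
proof
  show "trace_word T ` (T \<rightarrow> ext) \<subseteq> trace_code T"
  proof (rule image_subsetI)
    fix c assume "c \<in> T \<rightarrow> ext"
    hence "restrict c T \<in> T \<rightarrow>\<^sub>E ext" by auto
    thus "trace_word T c \<in> trace_code T"
      unfolding trace_code_def by (metis trace_word_restrict image_eqI)
  qed
qed (auto simp: trace_code_def)

lemma linear_code_trace_code: "linear_code n (trace_code T)"
  unfolding linear_code_def
proof (intro conjI ballI allI)
  show "trace_code T \<subseteq> carrier_vec n"
    by (auto simp: trace_code_def trace_word_carrier)
  have "trace_word T (\<lambda>_. 0) = 0\<^sub>v n" by (rule eq_vecI) (auto simp: trace_word_def tr_0)
  moreover have "(\<lambda>_. 0) \<in> T \<rightarrow> ext" using ext_0 by auto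
  ultimately show "0\<^sub>v n \<in> trace_code T" unfolding trace_code_eq by (metis image_eqI)
next
  fix x y assume "x \<in> trace_code T" "y \<in> trace_code T"
  then obtain c d where cd: "c \<in> T \<rightarrow> ext" "d \<in> T \<rightarrow> ext" "x = trace_word T c" "y = trace_word T d"
    by (auto simp: trace_code_eq)
  have s: "(\<lambda>a. c a + d a) \<in> T \<rightarrow> ext" using cd ext_add by auto
  have "x + y = trace_word T (\<lambda>a. c a + d a)"
  proof (rule eq_vecI)
    fix i assume "i < dim_vec (trace_word T (\<lambda>a. c a + d a))"
    hence i: "i < n" by (simp add: trace_word_def)
    have "to_ac ((x + y) $ i) = tr (\<Sum>a\<in>T. c a * \<beta> i ^ a) + tr (\<Sum>a\<in>T. d a * \<beta> i ^ a)"
      using cd i by (simp add: to_ac_trace_word carrier_vecD[OF trace_word_carrier])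
    also have "\<dots> = to_ac (trace_word T (\<lambda>a. c a + d a) $ i)"
      by (simp add: to_ac_trace_word[OF s i] distrib_right sum.distrib tr_add)
    finally show "(x + y) $ i = trace_word T (\<lambda>a. c a + d a) $ i" by simp
  qed (simp add: cd carrier_vecD[OF trace_word_carrier])
  thus "x + y \<in> trace_code T" unfolding trace_code_eq using s by blast
next
  fix k x assume "x \<in> trace_code T"
  then obtain c where c: "c \<in> T \<rightarrow> ext" "x = trace_word T c"
    by (auto simp: trace_code_eq)
  have s: "(\<lambda>a. to_ac k * c a) \<in> T \<rightarrow> ext" using c ext_mult ext_to_ac by auto
  have "k \<cdot>\<^sub>v x = trace_word T (\<lambda>a. to_ac k * c a)"
  proof (rule eq_vecI)
    fix i assume "i < dim_vec (trace_word T (\<lambda>a. to_ac k * c a))"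
    hence i: "i < n" by (simp add: trace_word_def)
    have "to_ac ((k \<cdot>\<^sub>v x) $ i) = to_ac k * tr (\<Sum>a\<in>T. c a * \<beta> i ^ a)"
      using c i by (simp add: to_ac_trace_word carrier_vecD[OF trace_word_carrier])
    also have "\<dots> = to_ac (trace_word T (\<lambda>a. to_ac k * c a) $ i)"
      by (simp add: to_ac_trace_word[OF s i] sum_distrib_left mult.assoc flip: tr_to_ac_mult)
    finally show "(k \<cdot>\<^sub>v x) $ i = trace_word T (\<lambda>a. to_ac k * c a) $ i" by simp
  qed (simp add: c carrier_vecD[OF trace_word_carrier])
  thus "k \<cdot>\<^sub>v x \<in> trace_code T" unfolding trace_code_eq using s by blast
qed

lemma card_trace_code:
  assumes "finite T"
  shows "card (trace_code T) \<le> CARD('a) ^ (m * card T)"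
proof -
  have "card (trace_code T) \<le> card (T \<rightarrow>\<^sub>E ext)"
    unfolding trace_code_def using assms finite_ext by (intro card_image_le finite_PiE) auto
  also have "\<dots> = CARD('a) ^ (m * card T)"
    using assms by (simp add: card_PiE card_ext power_mult)
  finally show ?thesis .
qed

lemma to_ac_scalar_prod_trace_word:
  assumes "y \<in> carrier_vec n" "c \<in> T \<rightarrow> ext"
  shows "to_ac (y \<bullet> trace_word T c) = tr (\<Sum>a\<in>T. c a * syndrome y a)"
proof -
  have "to_ac (y \<bullet> trace_word T c) = (\<Sum>i<n. to_ac (y $ i) * tr (\<Sum>a\<in>T. c a * \<beta> i ^ a))"
    using assms
    by (simp add: scalar_prod_def to_ac_sum to_ac_trace_word carrier_vecD[OF trace_word_carrier]
        atLeast0LessThan)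
  also have "\<dots> = tr (\<Sum>i<n. \<Sum>a\<in>T. to_ac (y $ i) * (c a * \<beta> i ^ a))"
    by (simp only: tr_sum[of _ "{..<n}"] sum_distrib_left [symmetric] tr_to_ac_mult)
  also have "(\<Sum>i<n. \<Sum>a\<in>T. to_ac (y $ i) * (c a * \<beta> i ^ a)) = (\<Sum>a\<in>T. c a * syndrome y a)"
    unfolding syndrome_def sum_distrib_left by (subst sum.swap) (simp add: mult_ac)
  finally show ?thesis .
qed

lemma dual_trace_code:
  assumes "finite T"
  shows "dual_code n (trace_code T) = {y \<in> carrier_vec n. \<forall>b\<in>T. syndrome y b = 0}"
proof (intro equalityI subsetI)
  fix y assume "y \<in> {y \<in> carrier_vec n. \<forall>b\<in>T. syndrome y b = 0}"
  hence y: "y \<in> carrier_vec n" "\<And>b. b \<in> T \<Longrightarrow> syndrome y b = 0" by auto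
  have "to_ac (y \<bullet> trace_word T c) = 0" if "c \<in> T \<rightarrow> ext" for c
    using to_ac_scalar_prod_trace_word[OF y(1) that] y(2) by (simp add: tr_0)
  thus "y \<in> dual_code n (trace_code T)" using y(1) by (auto simp: dual_code_def trace_code_eq)
next
  fix y assume y: "y \<in> dual_code n (trace_code T)"
  hence yc: "y \<in> carrier_vec n" by (simp add: dual_code_def)
  have "syndrome y b = 0" if b: "b \<in> T" for b
  proof (rule tr_nondegenerate[OF syndrome_ext])
    fix x assume x: "x \<in> ext"
    \<comment> \<open>Coefficients supported at \<open>b\<close> isolate
      \<open>tr (x * syndrome y b)\<close>; nondegeneracy of the trace finishes.\<close>
    define c where "c = (\<lambda>a. if a = b then x else 0)"
    have c: "c \<in> T \<rightarrow> ext" using x ext_0 by (auto simp: c_def)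
    have "(\<Sum>a\<in>T. c a * syndrome y a) = (\<Sum>a\<in>T. if a = b then x * syndrome y a else 0)"
      by (intro sum.cong) (auto simp: c_def)
    also have "\<dots> = x * syndrome y b" using assms b by simp
    finally have "tr (x * syndrome y b) = to_ac (y \<bullet> trace_word T c)"
      using to_ac_scalar_prod_trace_word[OF yc c] by simp
    also have "\<dots> = 0" using y c by (auto simp: dual_code_def trace_code_eq)
    finally show "tr (x * syndrome y b) = 0" .
  qed
  thus "y \<in> {y \<in> carrier_vec n. \<forall>b\<in>T. syndrome y b = 0}" using yc by auto
qed

text \<open>Expanding the trace turns each syndrome of a trace word into a combination of power sums
  of the roots of unity with exponents \<open>a * q ^ u + b\<close>, and all of these
  vanish.\<close>

lemma trace_code_self_orthogonal:
  assumes T: "finite T" and nd: "\<And>a b i. a \<in> T \<Longrightarrow> b \<in> T \<Longrightarrow> i < m \<Longrightarrow> \<not> n dvd a * CARD('a) ^ i + b"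
  shows "trace_code T \<subseteq> dual_code n (trace_code T)"
proof -
  have "syndrome (trace_word T c) b = 0" if c: "c \<in> T \<rightarrow> ext" and b: "b \<in> T" for c b
  proof -
    have "syndrome (trace_word T c) b
        = (\<Sum>i<n. \<Sum>u<m. \<Sum>a\<in>T. c a ^ (CARD('a) ^ u) * \<beta> i ^ (a * CARD('a) ^ u + b))"
      unfolding syndrome_def
    proof (intro sum.cong refl)
      fix i assume "i \<in> {..<n}"
      hence "to_ac (trace_word T c $ i) * \<beta> i ^ b = tr (\<Sum>a\<in>T. c a * \<beta> i ^ a) * \<beta> i ^ b"
        using c by (simp add: to_ac_trace_word)
      also have "\<dots> = (\<Sum>u<m. \<Sum>a\<in>T. c a ^ (CARD('a) ^ u) * \<beta> i ^ (a * CARD('a) ^ u + b))"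
        by (simp add: tr_def frobenius_sum sum_distrib_right power_mult_distrib power_add
            power_mult mult.assoc)
      finally show "to_ac (trace_word T c $ i) * \<beta> i ^ b = \<dots>" .
    qed
    also have "\<dots> = (\<Sum>u<m. \<Sum>a\<in>T. c a ^ (CARD('a) ^ u) * (\<Sum>i<n. \<beta> i ^ (a * CARD('a) ^ u + b)))"
      unfolding sum_distrib_left by (subst sum.swap, rule sum.cong[OF refl], rule sum.swap)
    also have "\<dots> = 0"
    proof (intro sum.neutral ballI)
      fix u a assume "u \<in> {..<m}" "a \<in> T"
      hence "\<not> n dvd a * CARD('a) ^ u + b" using nd b by simp
      moreover have "(\<Sum>i<n. \<beta> i ^ k) = (\<Sum>x | x ^ n = 1. x ^ k)" for k
        using sum.reindex_bij_betw[OF \<beta>, of "\<lambda>x. x ^ k"] by simp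
      ultimately show "c a ^ (CARD('a) ^ u) * (\<Sum>i<n. \<beta> i ^ (a * CARD('a) ^ u + b)) = 0"
        using sum_powers_of_roots_of_unity[OF of_nat_n_nonzero] by simp
    qed
    finally show ?thesis .
  qed
  thus ?thesis
    unfolding dual_trace_code[OF T] by (auto simp: trace_code_eq trace_word_carrier)
qed

section \<open>From vanishing syndromes to the minimum distance\<close>

lemma syndrome_zero_of_not_dvd:
  assumes "\<And>b. b \<in> {1..<\<delta>} \<Longrightarrow> \<not> CARD('a) dvd b \<Longrightarrow> syndrome y b = 0" and "t \<in> {1..<\<delta>}"
  shows "syndrome y t = 0"
  using assms(2)
proof (induction t rule: less_induct)
  case (less t)
  show ?case
  proof (cases "CARD('a) dvd t")
    case True
    then obtain b where b: "t = CARD('a) * b" by (elim dvdE)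
    have "b \<ge> 1" using less.prems b by (cases b) auto
    moreover have "b < t" using b CARD_field_ge_2[where 'a='a] \<open>b \<ge> 1\<close> by simp
    ultimately have "syndrome y b = 0" using less by simp
    thus ?thesis by (simp add: b syndrome_mult_q power_0_left)
  qed (use assms(1) less.prems in blast)
qed

text \<open>
  If \<open>P\<close> has degree less than \<open>\<delta>\<close> and \<open>P(0) = 0\<close>, then \<open>\<Sum> y\<^sub>i P(\<beta>\<^sub>i) = 0\<close>. The choice
  \<open>P = x \<Prod> (x - \<beta>\<^sub>j)\<close>, over all but one of the positions \<open>j\<close> in the support, gives the contradiction.
\<close>

lemma bch_bound:
  assumes y: "y \<in> carrier_vec n" "y \<noteq> 0\<^sub>v n"
    and syn: "\<And>t. t \<in> {1..<\<delta>} \<Longrightarrow> syndrome y t = 0"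
  shows "\<delta> \<le> card {i. i < n \<and> y $ i \<noteq> 0}"
proof (rule ccontr)
  assume less: "\<not> \<delta> \<le> card {i. i < n \<and> y $ i \<noteq> 0}"
  define S where "S = {i. i < n \<and> y $ i \<noteq> 0}"
  have S: "finite S" "card S < \<delta>" using less by (auto simp: S_def)
  obtain k where k: "k < n" "y $ k \<noteq> 0"
    using y by (metis carrier_vecD eq_vecI index_zero_vec)
  hence kS: "k \<in> S" by (simp add: S_def)
  define Q where "Q = (\<Prod>j\<in>S - {k}. [:- \<beta> j, 1:])"
  define P where "P = pCons 0 Q"
  have "Polynomial.degree Q = card (S - {k})"
    unfolding Q_def by (subst degree_prod_eq_sum_degree) auto
  hence deg: "Polynomial.degree P < \<delta>"
    using S kS degree_pCons_le[of 0 Q] card_Suc_Diff1[of S k] by (simp add: P_def)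
  have "(\<Sum>i<n. to_ac (y $ i) * poly P (\<beta> i))
      = (\<Sum>t\<le>Polynomial.degree P. Polynomial.coeff P t * syndrome y t)"
    unfolding poly_altdef syndrome_def sum_distrib_left
    by (subst sum.swap) (simp add: mult_ac)
  also have "\<dots> = 0"
  proof (intro sum.neutral ballI)
    fix t assume "t \<in> {..Polynomial.degree P}"
    thus "Polynomial.coeff P t * syndrome y t = 0"
      using syn[of t] deg by (cases t) (auto simp: P_def)
  qed
  finally have "(\<Sum>i<n. to_ac (y $ i) * poly P (\<beta> i)) = 0" .
  moreover have "(\<Sum>i<n. to_ac (y $ i) * poly P (\<beta> i))
      = (\<Sum>i\<in>{k}. to_ac (y $ i) * poly P (\<beta> i))"
  proof (rule sum.mono_neutral_right)
    show "\<forall>i\<in>{..<n} - {k}. to_ac (y $ i) * poly P (\<beta> i) = 0"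
    proof
      fix i assume i: "i \<in> {..<n} - {k}"
      show "to_ac (y $ i) * poly P (\<beta> i) = 0"
      proof (cases "i \<in> S")
        case True
        hence "poly Q (\<beta> i) = 0"
          unfolding Q_def poly_prod using S i by (intro prod_zero) (auto intro!: bexI[of _ i])
        thus ?thesis by (simp add: P_def)
      qed (use i in \<open>auto simp: S_def\<close>)
    qed
  qed (use k in auto)
  ultimately have "poly P (\<beta> k) = 0" using k by simp
  \<comment> \<open>The extra factor \<open>X\<close> of \<open>P\<close> cancels because roots of
    unity are nonzero.\<close>
  hence "poly Q (\<beta> k) = 0" using \<beta>_nonzero[OF k(1)] by (simp add: P_def)
  then obtain j where "j \<in> S - {k}" "\<beta> k = \<beta> j"
    using S by (auto simp: Q_def poly_prod)
  thus False using bij_betw_imp_inj_on[OF \<beta>] k by (auto simp: inj_on_def S_def)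
qed

end

section \<open>The size of \<open>T\<close> and the range of the designed distance\<close>

lemma card_not_dvd:
  fixes q k :: nat
  assumes "q \<ge> 1"
  shows "int (card {a \<in> {1..<Suc k}. \<not> q dvd a}) = \<lceil>real k * (1 - 1 / real q)\<rceil>"
proof -
  have "card {a \<in> {1..<Suc k}. \<not> q dvd a} + k div q = k"
  proof -
    let ?D = "{a \<in> {1..<Suc k}. q dvd a}" and ?N = "{a \<in> {1..<Suc k}. \<not> q dvd a}"
    have "bij_betw (\<lambda>j. q * j) {1..k div q} ?D"
    proof (rule bij_betwI[where g = "\<lambda>a. a div q"])
      show "(\<lambda>j. q * j) \<in> {1..k div q} \<rightarrow> ?D"
        using assms by (auto simp: less_eq_div_iff_mult_less_eq mult.commute)
      show "(\<lambda>a. a div q) \<in> ?D \<rightarrow> {1..k div q}"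
        using assms by (auto simp: less_eq_div_iff_mult_less_eq mult.commute elim!: dvdE)
    qed (use assms in auto)
    hence D: "card ?D = k div q" using bij_betw_same_card[of "\<lambda>j. q * j" "{1..k div q}" ?D] by simp
    have "card {1..<Suc k} = card (?N \<union> ?D)"
      by (rule arg_cong[where f = card]) auto
    also have "\<dots> = card ?N + card ?D"
      by (rule card_Un_disjoint) auto
    finally show ?thesis using D by simp
  qed
  \<comment> \<open>Subtracting \<open>k / q\<close> from the integer \<open>k\<close> turns the
    ceiling into a floor, which counts the multiples of \<open>q\<close> up to
    \<open>k\<close>.\<close>
  moreover have "\<lceil>real k * (1 - 1 / real q)\<rceil> = int k - int (k div q)"
  proof -
    have "real k * (1 - 1 / real q) = of_int (int k) + - (real k / real q)"
      by (simp add: algebra_simps)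
    also have "\<lceil>\<dots>\<rceil> = int k - \<lfloor>real k / real q\<rfloor>"
      using floor_correct[of "real k / real q"] by (intro ceiling_unique) (simp_all, linarith)
    finally show ?thesis by (simp add: floor_divide_of_nat_eq)
  qed
  ultimately show ?thesis by linarith
qed

text \<open>With \<open>Q = q ^ (m div 2)\<close>, the extreme cases are
  \<open>(Q - 2) * (Q + 1) = Q^2 - Q - 2\<close> for even \<open>m\<close> and
  \<open>(q * Q - q) * (Q + 1) = q * Q^2 - q\<close> for odd \<open>m\<close>, each below
  \<open>q ^ m - 1\<close>.\<close>

lemma designed_distance_bound:
  fixes q m \<delta> :: nat
  assumes q: "q \<ge> 2" and \<delta>: "\<delta> \<ge> 2"
    and le: "int \<delta> \<le> int q ^ nat \<lceil>real m / 2\<rceil> - 1 - (int q - 2) * of_bool (odd m)"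
  shows "(\<delta> - 1) * (q ^ (m div 2) + 1) < q ^ m - 1"
proof -
  define h where "h = m div 2"
  define Q where "Q = int q ^ h"
  have Q: "Q \<ge> 1" using q by (simp add: Q_def)
  have "(int \<delta> - 1) * (Q + 1) < int q ^ m - 1"
  proof (cases "even m")
    case True
    hence m: "m = 2 * h" by (simp add: h_def)
    hence N: "nat \<lceil>real m / 2\<rceil> = h" by simp
    have "of_bool (odd m) = (0 :: int)" using True by simp
    with le have "int \<delta> \<le> Q - 1 - (int q - 2) * 0" unfolding N Q_def by metis
    hence "int \<delta> - 1 \<le> Q - 2" by simp
    hence "(int \<delta> - 1) * (Q + 1) \<le> (Q - 2) * (Q + 1)" using Q by (intro mult_right_mono) auto
    also have "\<dots> = Q * Q - Q - 2" by (simp add: algebra_simps)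
    also have "\<dots> < Q * Q - 1" using Q by simp
    also have "Q * Q = int q ^ m" by (simp add: Q_def m mult_2 power_add)
    finally show ?thesis .
  next
    case False
    hence m: "m = 2 * h + 1" by (simp add: h_def)
    hence "\<lceil>real m / 2\<rceil> = int h + 1" by (intro ceiling_unique) auto
    hence "nat \<lceil>real m / 2\<rceil> = h + 1" by simp
    \<comment> \<open>For odd \<open>m\<close> the correction term is \<open>q - 2\<close>, and
      \<open>-1 - (q - 2) - 1 = -q\<close>.\<close>
    hence "int \<delta> - 1 \<le> int q * Q - int q" using le False by (simp add: Q_def)
    hence "(int \<delta> - 1) * (Q + 1) \<le> (int q * Q - int q) * (Q + 1)"
      using Q by (intro mult_right_mono) auto
    also have "\<dots> = int q * (Q * Q) - int q" by (simp add: algebra_simps)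
    also have "\<dots> < int q * (Q * Q) - 1" using q by simp
    also have "int q * (Q * Q) = int q ^ m" by (simp add: Q_def m mult_2 power_add)
    finally show ?thesis .
  qed
  moreover have "int (\<delta> - 1) = int \<delta> - 1" using \<delta> by simp
  hence "int ((\<delta> - 1) * (q ^ (m div 2) + 1)) = (int \<delta> - 1) * (Q + 1)"
    by (simp only: of_nat_mult of_nat_add of_nat_power of_nat_1 Q_def h_def)
  moreover have "int (q ^ m - 1) = int q ^ m - 1" using q by (simp add: of_nat_diff)
  ultimately show ?thesis by linarith
qed

theorem corollary16:
  fixes q m n \<delta> r :: nat
  assumes "q = CARD('a::{finite,field})"
    and "m \<ge> 1"
    and "n = q ^ m - 1"
    and "2 \<le> \<delta>"
    and "int \<delta> \<le> int q ^ nat \<lceil>real m / 2\<rceil> - 1 - (int q - 2) * of_bool (odd m)"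
    and "int r < int n - 2 * int m * \<lceil>(real \<delta> - 1) * (1 - 1 / real q)\<rceil>"
  shows "\<exists>d \<ge> \<delta>. exists_subsystem_code TYPE('a) n
           (nat (int n - 2 * int m * \<lceil>(real \<delta> - 1) * (1 - 1 / real q)\<rceil> - int r)) r d"
proof -
  have q: "q \<ge> 2" using assms(1) CARD_field_ge_2[where 'a='a] by simp
  have ne: "of_nat n \<noteq> (0 :: 'a alg_closure)"
    unfolding assms(1,3) by (rule of_nat_card_power_minus_1_nonzero[OF assms(2)])
  obtain \<beta> :: "nat \<Rightarrow> 'a alg_closure" where \<beta>: "bij_betw \<beta> {..<n} {x. x ^ n = 1}"
    using ex_bij_betw_nat_finite[OF card_nth_roots_of_unity(2)[OF ne]]
      card_nth_roots_of_unity(1)[OF ne] by (auto simp: atLeast0LessThan)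
  interpret bch m n \<beta>
    using assms(1-3) \<beta> by unfold_locales auto
  define T where "T = {a \<in> {1..<\<delta>}. \<not> q dvd a}"
  define s where "s = m * card T"
  have T: "finite T" by (simp add: T_def)
  \<comment> \<open>The range \<open>{1..<\<delta>}\<close> has \<open>\<delta> - 1\<close>
    elements, so the count is taken at \<open>k = \<delta> - 1\<close>.\<close>
  have "int (card T) = \<lceil>(real \<delta> - 1) * (1 - 1 / real q)\<rceil>"
    using card_not_dvd[of q "\<delta> - 1"] q assms(4) by (simp add: T_def of_nat_diff)
  hence s: "2 * int m * \<lceil>(real \<delta> - 1) * (1 - 1 / real q)\<rceil> = int (2 * s)"
    by (simp add: s_def flip: \<open>int (card T) = _\<close>)
  have less: "2 * s + r < n" using assms(6) unfolding s by linarith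
  have "\<not> n dvd a * CARD('a) ^ i + b" if "a \<in> T" "b \<in> T" "i < m" for a b i
  proof -
    have "1 \<le> a" "a \<le> \<delta> - 1" "1 \<le> b" "b \<le> \<delta> - 1" using that by (auto simp: T_def)
    thus ?thesis
      using not_dvd_cyclotomic_sum[OF designed_distance_bound[OF q assms(4,5)], of a b i] that
      by (simp add: assms(1,3))
  qed
  hence "trace_code T \<subseteq> dual_code n (trace_code T)"
    by (rule trace_code_self_orthogonal[OF T])
  moreover have "card (trace_code T) \<le> CARD('a) ^ s"
    unfolding s_def by (rule card_trace_code[OF T])
  moreover have "\<delta> \<le> card {i. i < n \<and> x $ i \<noteq> 0}"
    if "x \<in> dual_code n (trace_code T)" "x \<noteq> 0\<^sub>v n" for x
  proof (rule bch_bound)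
    \<comment> \<open>Duality gives zeros on \<open>T\<close> only; the multiples of
      \<open>q\<close> below \<open>\<delta>\<close> follow by conjugation.\<close>
    have "syndrome x b = 0" if "b \<in> T" for b
      using that \<open>x \<in> dual_code n (trace_code T)\<close> unfolding dual_trace_code[OF T] by blast
    thus "syndrome x t = 0" if "t \<in> {1..<\<delta>}" for t
      using syndrome_zero_of_not_dvd[OF _ that] by (simp add: T_def assms(1))
  qed (use that in \<open>auto simp: dual_code_def\<close>)
  ultimately have "\<exists>d\<ge>\<delta>. exists_subsystem_code TYPE('a) n (n - 2 * s - r) r d"
    using exists_subsystem_code_if_self_orthogonal[OF linear_code_trace_code] less by blast
  moreover have "nat (int n - int (2 * s) - int r) = n - 2 * s - r" by linarith
  ultimately show ?thesis unfolding s by simp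
qed

end
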